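(* Let $x\in\mathbb{R}^p_+$ be such that $F_X(x)>0$. (i) If there exist $b_n>0$ and some non-degenerate distribution function $G_x$ such that $$b_n^{-1}\bigl(\hat\varphi_1(x)-\varphi(x)\bigr)\stackrel{d}{\longrightarrow}G_x ,$$ then $G_x(y)$ coincides with $\Psi_{\rho_x}(y)=\exp\{-(-y)^{\rho_x}\}$ with support $]-\infty,0]$ for some $\rho_x>0$. (ii) There exists $b_n>0$ such that $b_n^{-1}(\hat\varphi_1(x)-\varphi(x))$ converges in distribution if and only if $$\lim_{t\to\infty}\frac{1-F\bigl(\varphi(x)-\frac{1}{tz}\mid x\bigr)}{1-F\bigl(\varphi(x)-\frac1t\mid x\bigr)}=z^{-\rho_x}\qquad\text{for all } z>0, \tag{RV}$$ that is, $t\mapsto 1-F(\varphi(x)-\frac1t\mid x)$ is regularly varying as $t\to\infty$ with exponent $-\rho_x$. In this case, the norming constants $b_n$ can be chosen as $b_n=\varphi(x)-\varphi_{1-(1/nF_X(x))}(x)$. (iii) Given (RV), $$\lim_{n\to\infty}\mathbb{E}\bigl\{b_n^{-1}\bigl(\varphi(x)-\hat\varphi_1(x)\bigr)\bigr\}^k=\Gamma(1+k\rho_x^{-1})\qquad\text{for all integers } k\ge1,$$ where $b_n$ are the norming constants of (ii), and $$\lim_{n\to\infty}\mathbb{P}\left[\frac{\hat\varphi_1(x)-\mathbb{E}(\hat\varphi_1(x))}{\{\operatorname{Var}(\hat\varphi_1(x))\}^{1/2}}\le y\right]=\Psi_{\rho_x}\Bigl[\{\Gamma(1+2\rho_x^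{-1})-\Gamma^2(1+\rho_x^{-1})\}^{1/2}\,y-\Gamma(1+\rho_x^{-1})\Bigr].$$
   Context: $(X,Y)$ is a random vector in $\mathbb{R}^p_+\times\mathbb{R}_+$ with joint distribution function $F(x,y)=\mathbb{P}(X\le x,Y\le y)$ (inequalities between vectors are componentwise), and $(X_i,Y_i)$, $i=1,\dots,n$, is an i.i.d. sample from $(X,Y)$. Put $F_X(x)=F(x,\infty)$ and, for $F_X(x)>0$, $F(y|x)=F(x,y)/F_X(x)$, the conditional distribution function of $Y$ given $X\le x$. The frontier function is $\varphi(x)=\sup\{y\ge0: F(y|x)<1\}$. For $\alpha\in\,]0,1]$, $\varphi_\alpha(x)=\inf\{y\ge0: F(y|x)\ge\alpha\}$ is the conditional $\alpha$-quantile, so that $\varphi_1(x)=\varphi(x)$. The free disposal hull (FDH) estimator of $\varphi(x)$ is $\hat\varphi_1(x)=\sup\{y\ge0:\hat F(y|x)<1\}=\max_{i: X_i\le x}Y_i$, where $\hat F(y|x)=\hat F_n(x,y)/\hat F_X(x)$, $\hat F_n(x,y)=\frac1n\sum_{i=1}^n\mathbf{1}(X_i\le x,Y_i\le y)$ and $\hat F_X(x)=\hat F_n(x,\infty)$. Limits in distribution are as $n\to\infty$. $\Gamma$ is the gamma function, and the parameter $\rho_x$ is positive throughout.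
   Formalization: In (i), G_x is identified with Ψ_ρ only up to a positive scale factor, G_x(y)=Ψ_ρ(y/c), since rescaling b_n rescales G_x; in (ii), convergence means to a non-degenerate limit, since degenerate limits break the equivalence; φ(x) is assumed finite. *)

theory Defs
  imports "HOL-Probability.Probability"
begin

text \<open>The order on \<^typ>\<open>real ^ 'p\<close> is the componentwise one.\<close>

definition joint_df ::
  "'a measure \<Rightarrow> ('a \<Rightarrow> real ^ 'p) \<Rightarrow> ('a \<Rightarrow> real) \<Rightarrow> real ^ 'p \<Rightarrow> real \<Rightarrow> real" where
  "joint_df M X Y x y = measure M {\<omega> \<in> space M. X \<omega> \<le> x \<and> Y \<omega> \<le> y}"

definition marginal_df :: "'a measure \<Rightarrow> ('a \<Rightarrow> real ^ 'p) \<Rightarrow> real ^ 'p \<Rightarrow> real" where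
  "marginal_df M X x = measure M {\<omega> \<in> space M. X \<omega> \<le> x}"

definition cond_df ::
  "'a measure \<Rightarrow> ('a \<Rightarrow> real ^ 'p) \<Rightarrow> ('a \<Rightarrow> real) \<Rightarrow> real ^ 'p \<Rightarrow> real \<Rightarrow> real" where
  "cond_df M X Y x y = joint_df M X Y x y / marginal_df M X x"

text \<open>
  Suprema of subsets of the nonnegative reals are taken in the nonnegative reals; inserting 0
  has no effect on a nonempty set and makes the supremum of the empty set equal to 0
  (the real \<^term>\<open>Sup {}\<close> is unspecified). The frontier is meaningful only if the set is
  bounded above, that is, if the frontier is finite at \<open>x\<close>.
\<close>

definition frontier_set ::
  "'a measure \<Rightarrow> ('a \<Rightarrow> real ^ 'p) \<Rightarrow> ('a \<Rightarrow> real) \<Rightarrow> real ^ 'p \<Rightarrow> real set" where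
  "frontier_set M X Y x = {y. 0 \<le> y \<and> cond_df M X Y x y < 1}"

definition frontier_fun ::
  "'a measure \<Rightarrow> ('a \<Rightarrow> real ^ 'p) \<Rightarrow> ('a \<Rightarrow> real) \<Rightarrow> real ^ 'p \<Rightarrow> real" where
  "frontier_fun M X Y x = Sup (insert 0 (frontier_set M X Y x))"

text \<open>For \<open>\<alpha> \<le> 0\<close>, outside the range of the usual definition, this formula gives 0.\<close>

definition cond_quantile ::
  "'a measure \<Rightarrow> ('a \<Rightarrow> real ^ 'p) \<Rightarrow> ('a \<Rightarrow> real) \<Rightarrow> real \<Rightarrow> real ^ 'p \<Rightarrow> real" where
  "cond_quantile M X Y \<alpha> x = Inf {y. 0 \<le> y \<and> \<alpha> \<le> cond_df M X Y x y}"

text \<open>Empirical versions for the sample of size \<open>n\<close> with indices \<open>0, \<dots>, n - 1\<close>.\<close>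

definition emp_joint_df ::
  "(nat \<Rightarrow> 'a \<Rightarrow> real ^ 'p) \<Rightarrow> (nat \<Rightarrow> 'a \<Rightarrow> real) \<Rightarrow> nat \<Rightarrow> real ^ 'p \<Rightarrow> real \<Rightarrow> 'a \<Rightarrow> real" where
  "emp_joint_df Xs Ys n x y \<omega> = 1 / real n * (\<Sum>i<n. of_bool (Xs i \<omega> \<le> x \<and> Ys i \<omega> \<le> y))"

definition emp_marginal_df ::
  "(nat \<Rightarrow> 'a \<Rightarrow> real ^ 'p) \<Rightarrow> nat \<Rightarrow> real ^ 'p \<Rightarrow> 'a \<Rightarrow> real" where
  "emp_marginal_df Xs n x \<omega> = 1 / real n * (\<Sum>i<n. of_bool (Xs i \<omega> \<le> x))"

definition emp_cond_df ::
  "(nat \<Rightarrow> 'a \<Rightarrow> real ^ 'p) \<Rightarrow> (nat \<Rightarrow> 'a \<Rightarrow> real) \<Rightarrow> nat \<Rightarrow> real ^ 'p \<Rightarrow> real \<Rightarrow> 'a \<Rightarrow> real" where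
  "emp_cond_df Xs Ys n x y \<omega> = emp_joint_df Xs Ys n x y \<omega> / emp_marginal_df Xs n x \<omega>"

text \<open>
  If no \<open>Xs i\<close> lies below \<open>x\<close>, the empirical conditional distribution function is 0/0 and the
  maximum is over the empty set; the estimator is then 0 by convention.
\<close>

definition fdh ::
  "(nat \<Rightarrow> 'a \<Rightarrow> real ^ 'p) \<Rightarrow> (nat \<Rightarrow> 'a \<Rightarrow> real) \<Rightarrow> nat \<Rightarrow> real ^ 'p \<Rightarrow> 'a \<Rightarrow> real" where
  "fdh Xs Ys n x \<omega> =
     (if emp_marginal_df Xs n x \<omega> = 0 then 0
      else Sup (insert 0 {y. 0 \<le> y \<and> emp_cond_df Xs Ys n x y \<omega> < 1}))"

lemma fdh_eq_Max:
  "fdh Xs Ys n x \<omega> = Max (insert 0 {Ys i \<omega> | i. i < n \<and> Xs i \<omega> \<le> x})"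
proof -
  define I where "I = {i. i < n \<and> Xs i \<omega> \<le> x}"
  have fin: "finite I" by (simp add: I_def)
  have img: "{Ys i \<omega> | i. i < n \<and> Xs i \<omega> \<le> x} = (\<lambda>i. Ys i \<omega>) ` I"
    by (auto simp: I_def)
  have marg: "emp_marginal_df Xs n x \<omega> = real (card I) / real n"
    by (simp add: emp_marginal_df_def I_def sum_of_bool_eq Int_def)
  have joint: "emp_joint_df Xs Ys n x y \<omega> = real (card {i \<in> I. Ys i \<omega> \<le> y}) / real n" for y
  proof -
    have "{..<n} \<inter> {i. Xs i \<omega> \<le> x \<and> Ys i \<omega> \<le> y} = {i \<in> I. Ys i \<omega> \<le> y}"
      by (auto simp: I_def)
    then show ?thesis
      by (simp add: emp_joint_df_def sum_of_bool_eq)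
  qed
  show ?thesis
  proof (cases "I = {}")
    case True
    then show ?thesis by (simp only: img) (simp add: fdh_def marg)
  next
    case False
    then have n: "n > 0" and cI: "card I > 0"
      using fin by (auto simp: I_def card_gt_0_iff)
    have lt: "emp_cond_df Xs Ys n x y \<omega> < 1 \<longleftrightarrow> (\<exists>i\<in>I. y < Ys i \<omega>)" for y
    proof -
      have "emp_cond_df Xs Ys n x y \<omega> < 1 \<longleftrightarrow> card {i \<in> I. Ys i \<omega> \<le> y} < card I"
        using n cI by (simp add: emp_cond_df_def joint marg divide_simps)
      also have "\<dots> \<longleftrightarrow> {i \<in> I. Ys i \<omega> \<le> y} \<noteq> I"
        using fin by (metis (no_types, lifting) mem_Collect_eq nat_less_le psubset_card_mono psubsetI subsetI)
      also have "\<dots> \<longleftrightarrow> (\<exists>i\<in>I. y < Ys i \<omega>)" by (force simp: not_le)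
      finally show ?thesis .
    qed
    define A where "A = insert 0 ((\<lambda>i. Ys i \<omega>) ` I)"
    have A: "finite A" "A \<noteq> {}" using fin by (auto simp: A_def)
    have "Sup (insert 0 {y. 0 \<le> y \<and> (\<exists>i\<in>I. y < Ys i \<omega>)}) = Max A"
    proof (cases "Max A = 0")
      case True
      then have "Ys i \<omega> \<le> 0" if "i \<in> I" for i
        using Max_ge[OF A(1), of "Ys i \<omega>"] that by (auto simp: A_def)
      then have "{y. 0 \<le> y \<and> (\<exists>i\<in>I. y < Ys i \<omega>)} = {}" by force
      then show ?thesis unfolding True by (simp only: cSup_singleton)
    next
      case False
      have "0 \<le> Max A" using A by (intro Max_ge) (auto simp: A_def)
      then have pos: "0 < Max A" using False by simp
      have "{y. 0 \<le> y \<and> (\<exists>i\<in>I. y < Ys i \<omega>)} = {0..<Max A}"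
        using A by (auto simp: Max_gr_iff A_def)
      then have "insert 0 {y. 0 \<le> y \<and> (\<exists>i\<in>I. y < Ys i \<omega>)} = {0..<Max A}"
        using pos by auto
      then show ?thesis using pos by simp
    qed
    then show ?thesis
      using n cI by (simp only: img) (simp add: fdh_def marg lt A_def)
  qed
qed

definition distribution_function :: "(real \<Rightarrow> real) \<Rightarrow> bool" where
  "distribution_function G \<longleftrightarrow> (\<exists>\<mu>. real_distribution \<mu> \<and> G = cdf \<mu>)"

definition degenerate_df :: "(real \<Rightarrow> real) \<Rightarrow> bool" where
  "degenerate_df G \<longleftrightarrow> (\<exists>a. G = indicator {a..})"

definition Psi :: "real \<Rightarrow> real \<Rightarrow> real" where
  "Psi \<rho> y = (if y < 0 then exp (- ((- y) powr \<rho>)) else 1)"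

text \<open>Convergence in distribution of \<open>(fdh - frontier) / b n\<close> to the distribution function \<open>G\<close>.\<close>

definition fdh_converges ::
  "'a measure \<Rightarrow> ('a \<Rightarrow> real ^ 'p) \<Rightarrow> ('a \<Rightarrow> real) \<Rightarrow> (nat \<Rightarrow> 'a \<Rightarrow> real ^ 'p) \<Rightarrow> (nat \<Rightarrow> 'a \<Rightarrow> real) \<Rightarrow>
   real ^ 'p \<Rightarrow> (nat \<Rightarrow> real) \<Rightarrow> (real \<Rightarrow> real) \<Rightarrow> bool" where
  "fdh_converges M X Y Xs Ys x b G \<longleftrightarrow>
     weak_conv
       (\<lambda>n. cdf (distr M borel (\<lambda>\<omega>. inverse (b n) * (fdh Xs Ys n x \<omega> - frontier_fun M X Y x)))) G"

definition frontier_RV ::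
  "'a measure \<Rightarrow> ('a \<Rightarrow> real ^ 'p) \<Rightarrow> ('a \<Rightarrow> real) \<Rightarrow> real ^ 'p \<Rightarrow> real \<Rightarrow> bool" where
  "frontier_RV M X Y x \<rho> \<longleftrightarrow>
     (\<forall>z>0. ((\<lambda>t. (1 - cond_df M X Y x (frontier_fun M X Y x - 1 / (t * z))) /
                   (1 - cond_df M X Y x (frontier_fun M X Y x - 1 / t)))
              \<longlongrightarrow> z powr (- \<rho>)) at_top)"

definition quantile_norming ::
  "'a measure \<Rightarrow> ('a \<Rightarrow> real ^ 'p) \<Rightarrow> ('a \<Rightarrow> real) \<Rightarrow> real ^ 'p \<Rightarrow> nat \<Rightarrow> real" where
  "quantile_norming M X Y x n =
     frontier_fun M X Y x - cond_quantile M X Y (1 - 1 / (real n * marginal_df M X x)) x"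

end

theory Submission
  imports Defs
begin

text \<open>The estimator is a maximum, so its law is explicit. Let \<open>V s\<close> be the probability that one observation
satisfies \<open>X \<le> x\<close> and \<open>Y > \<phi> - s\<close>, where \<open>\<phi>\<close> is the frontier at \<open>x\<close>. By independence
\<open>P (est n \<le> \<phi> - s) = (1 - V s)\<^sup>n\<close> as long as \<open>\<phi> - s \<ge> 0\<close>. For \<open>s > \<phi>\<close> the estimator, being nonnegative,
gives probability 0, while \<open>(1 - V s)\<^sup>n\<close> is \<open>(1 - F\<^sub>X x)\<^sup>n\<close>, which tends to 0. So every question about
limits in distribution of \<open>(est n - \<phi>) / b n\<close> is a question about the sequences \<open>(1 - V (b n * s))\<^sup>n\<close> for
\<open>s > 0\<close>, and, when the limit is \<open>exp (- L s)\<close> with \<open>L s\<close> finite, about \<open>n * V (b n * s)\<close>. The condition (RV)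
says that \<open>V\<close> is regularly varying at 0 with index \<open>\<rho>\<close>.

\<^bold>\<open>Form of the limit.\<close> Let \<open>h s = G (- s)\<close>. Along the indices \<open>a * j\<close> and \<open>c * j\<close> the same function \<open>V\<close> is
rescaled by \<open>b (a * j)\<close> and by \<open>b (c * j)\<close>, and the limits are \<open>h\<close> and a power of \<open>h\<close>. Convergence of types
(lemma \<open>convergence_of_types\<close>) then gives, for every rational \<open>r > 0\<close>, a \<open>\<tau> > 0\<close> with
\<open>h (\<tau> * s) = h s powr r\<close>. On a doubly logarithmic scale this is a monotone function that has
arbitrarily small constant increments over fixed steps, and such a function is affine
(lemma \<open>mono_with_small_increments_affine\<close>). Hence \<open>h s = exp (- (\<kappa> * s powr \<rho>))\<close>.

\<^bold>\<open>Regular variation.\<close> If \<open>n * V (b n * s)\<close> tends to \<open>\<kappa> * s powr \<rho>\<close>, then for small \<open>u\<close> take \<open>n\<close> close to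
\<open>1 / V u\<close>. Monotonicity pins \<open>u / b n\<close> near the point where \<open>\<kappa> * s powr \<rho> = 1\<close>, and so
\<open>V (u * z) / V u\<close>, which is close to \<open>n * V (u * z)\<close>, tends to \<open>z powr \<rho>\<close>. Conversely, under (RV) the quantile scale
\<open>a n\<close> is where \<open>V\<close> passes the level \<open>1 / n\<close>, whence \<open>n * V (a n)\<close> tends to 1 and \<open>n * V (a n * s)\<close> to
\<open>s powr \<rho>\<close>.

\<^bold>\<open>Moments.\<close> Write \<open>W n = (\<phi> - est n) / b n\<close>. The \<open>k\<close>-th moment is the integral of
\<open>k * s ^ (k - 1) * P (s \<le> W n)\<close>. A lower bound of Potter type for \<open>V\<close> dominates these tails by
\<open>exp (- (c * s powr (\<rho> / 2)))\<close>, and dominated convergence gives the moments of the Weibull law, which are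
values of the gamma function. The first two moments describe the centring and the scaling in the last claim;
since the limit law is continuous, convergence of the monotone distribution functions also holds along the convergent
sequence of arguments that standardization produces.\<close>

section \<open>Convergence of types and power-stable limits\<close>

definition dense_in_pos :: "real set \<Rightarrow> bool" where
  "dense_in_pos C \<longleftrightarrow> (\<forall>a b. 0 < a \<and> a < b \<longrightarrow> (\<exists>s\<in>C. a < s \<and> s < b))"

text \<open>The reflection \<open>s \<mapsto> G (- s)\<close>, on the positive half-line, of a distribution function \<open>G\<close> that is
not identically 0 on the negative half-line; right continuity of \<open>G\<close> becomes left continuity.\<close>

definition left_cont_tail :: "(real \<Rightarrow> real) \<Rightarrow> bool" where
  "left_cont_tail h \<longleftrightarrow>
     (\<forall>s t. 0 < s \<and> s \<le> t \<longrightarrow> h t \<le> h s) \<and> (\<forall>s>0. 0 \<le> h s) \<and>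
     (\<forall>s>0. (h \<longlongrightarrow> h s) (at_left s)) \<and> (\<forall>e>0. \<exists>s>0. h s < e) \<and> (\<exists>s>0. 0 < h s)"

lemma left_cont_tailD:
  assumes "left_cont_tail h"
  shows "0 < s \<Longrightarrow> s \<le> t \<Longrightarrow> h t \<le> h s" "0 < s \<Longrightarrow> 0 \<le> h s"
    "0 < s \<Longrightarrow> (h \<longlongrightarrow> h s) (at_left s)" "0 < e \<Longrightarrow> \<exists>s>0. h s < e" "\<exists>s>0. 0 < h s"
  using assms unfolding left_cont_tail_def by blast+

lemma dense_in_posD:
  assumes "dense_in_pos C" "0 \<le> a" "a < b"
  obtains s where "s \<in> C" "a < s" "s < b"
proof (cases "a = 0")
  case True
  then show ?thesis
    using assms that unfolding dense_in_pos_def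
    by (metis dual_order.strict_trans field_lbound_gt_zero)
next
  case False
  then show ?thesis
    using assms that unfolding dense_in_pos_def by (metis less_eq_real_def)
qed

lemma left_limit_le:
  fixes h :: "real \<Rightarrow> real"
  assumes "(h \<longlongrightarrow> h s) (at_left s)" "0 < s" "\<And>v. 0 < v \<Longrightarrow> v < s \<Longrightarrow> c \<le> h v"
  shows "c \<le> h s"
proof (rule tendsto_lowerbound[OF assms(1)])
  show "eventually (\<lambda>v. c \<le> h v) (at_left s)"
    using eventually_at_left_real[OF assms(2)] by eventually_elim (use assms(3) in auto)
qed simp

text \<open>If the scales \<open>R j\<close> became arbitrarily small, then \<open>k j (R j * s)\<close> would infinitely often be at
least \<open>k j s0\<close>, for any fixed \<open>s\<close> and \<open>s0\<close>. Take \<open>s0\<close> with \<open>h s0 > 0\<close> and then \<open>s\<close> with \<open>g s < h s0\<close>: the limits forbid this.\<close>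

lemma scales_bounded_below:
  fixes k :: "nat \<Rightarrow> real \<Rightarrow> real"
  assumes k: "\<And>j s t. 0 < s \<Longrightarrow> s \<le> t \<Longrightarrow> k j t \<le> k j s"
    and R: "\<And>j. 0 < R j" and C: "dense_in_pos C"
    and kh: "\<And>s. s \<in> C \<Longrightarrow> 0 < s \<Longrightarrow> (\<lambda>j. k j s) \<longlonglongrightarrow> h s"
    and kg: "\<And>s. s \<in> C \<Longrightarrow> 0 < s \<Longrightarrow> (\<lambda>j. k j (R j * s)) \<longlonglongrightarrow> g s"
    and h: "left_cont_tail h" and g: "left_cont_tail g"
  shows "\<exists>c>0. eventually (\<lambda>j. c \<le> R j) sequentially"
proof -
  obtain s' where "s' > 0" "0 < h s'" using left_cont_tailD(5)[OF h] by blast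
  then obtain s0 where s0: "s0 \<in> C" "s0 > 0" "0 < h s0"
    using dense_in_posD[OF C, of 0 s'] left_cont_tailD(1)[OF h]
    by (metis less_eq_real_def less_le_trans order_refl)
  obtain s1 where "s1 > 0" "g s1 < h s0" using left_cont_tailD(4)[OF g] s0 by blast
  then obtain s where s: "s \<in> C" "s > 0" "g s < h s0"
    using dense_in_posD[OF C, of s1 "s1+1"] left_cont_tailD(1)[OF g, of s1]
    by (metis less_add_one less_eq_real_def less_trans le_less_trans)
  obtain c where c: "g s < c" "c < h s0" using s dense by blast
  have "eventually (\<lambda>j. k j (R j * s) < c \<and> c < k j s0) sequentially"
    using order_tendstoD(2)[OF kg[OF s(1,2)] c(1)] order_tendstoD(1)[OF kh[OF s0(1,2)] c(2)]
    by eventually_elim auto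
  then have "eventually (\<lambda>j. s0 / s \<le> R j) sequentially"
  proof eventually_elim
    case (elim j)
    then have "\<not> R j * s \<le> s0"
      using k[of "R j * s" s0 j] R[of j] s(2) by (meson less_trans mult_pos_pos not_le)
    then show ?case using s(2) by (simp add: field_simps)
  qed
  then show ?thesis using s(2) s0(2) by (intro exI[of _ "s0/s"]) auto
qed

text \<open>The scales stay in a compact subset of the positive half-line, so a subsequence converges to some \<open>\<tau>\<close>.
Monotonicity traps \<open>g s\<close> between values of \<open>h\<close> at continuity points on either side of \<open>\<tau> * s\<close>, and
left continuity turns this into an equation.\<close>

lemma convergence_of_types:
  fixes k :: "nat \<Rightarrow> real \<Rightarrow> real"
  assumes k: "\<And>j s t. 0 < s \<Longrightarrow> s \<le> t \<Longrightarrow> k j t \<le> k j s"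
    and R: "\<And>j. 0 < R j" and C: "dense_in_pos C"
    and kh: "\<And>s. s \<in> C \<Longrightarrow> 0 < s \<Longrightarrow> (\<lambda>j. k j s) \<longlonglongrightarrow> h s"
    and kg: "\<And>s. s \<in> C \<Longrightarrow> 0 < s \<Longrightarrow> (\<lambda>j. k j (R j * s)) \<longlonglongrightarrow> g s"
    and h: "left_cont_tail h" and g: "left_cont_tail g"
  obtains \<tau> where "0 < \<tau>" "\<And>s. 0 < s \<Longrightarrow> g s = h (\<tau> * s)"
proof -
  obtain c where c: "c > 0" "eventually (\<lambda>j. c \<le> R j) sequentially"
    using scales_bounded_below[OF k R C kh kg h g] by blast
  \<comment> \<open>an upper bound is a lower bound for the inverse scales, with the roles of the limits exchanged\<close>
  have "\<exists>d>0. eventually (\<lambda>j. d \<le> inverse (R j)) sequentially"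
  proof (rule scales_bounded_below[of "\<lambda>j s. k j (R j * s)" "\<lambda>j. inverse (R j)", OF _ _ C _ _ g h])
    show "k j (R j * t) \<le> k j (R j * s)" if "0 < s" "s \<le> t" for j s t
      using that R[of j] by (intro k) auto
    show "(\<lambda>j. k j (R j * (inverse (R j) * s))) \<longlonglongrightarrow> h s" if "s \<in> C" "0 < s" for s
    proof -
      have "R j * (inverse (R j) * s) = s" for j using R[of j] by (simp add: field_simps)
      then have "(\<lambda>j. k j (R j * (inverse (R j) * s))) = (\<lambda>j. k j s)" by presburger
      then show ?thesis using kh[OF that] by presburger
    qed
  qed (use R kg in auto)
  then obtain d where d: "d > 0" "eventually (\<lambda>j. d \<le> inverse (R j)) sequentially" by blast
  have "eventually (\<lambda>j. R j \<in> {c..inverse d}) sequentially"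
    using c(2) d(2)
  proof eventually_elim
    case (elim j)
    have "R j \<le> inverse d" using elim(2) d(1) R[of j]
      by (metis inverse_inverse_eq le_imp_inverse_le)
    with elim show ?case by simp
  qed
  then obtain N where N: "\<And>j. j \<ge> N \<Longrightarrow> R j \<in> {c..inverse d}"
    by (auto simp: eventually_sequentially)
  have "seq_compact {c..inverse d}" by (simp add: compact_imp_seq_compact)
  then obtain \<tau> r where r: "\<tau> \<in> {c..inverse d}" "strict_mono r" "((\<lambda>j. R (j + N)) \<circ> r) \<longlonglongrightarrow> \<tau>"
    using N by (elim seq_compactE[where f = "\<lambda>j. R (j + N)"]) auto
  define q where "q j = r j + N" for j
  have q: "filterlim q at_top sequentially"
    unfolding q_def using filterlim_subseq[OF r(2)] by (rule filterlim_at_top_mono) auto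
  have Rq: "(\<lambda>j. R (q j)) \<longlonglongrightarrow> \<tau>" using r(3) by (simp add: q_def o_def)
  have tau: "\<tau> > 0" using r c by auto
  have ge: "h v \<le> g s" if "s \<in> C" "0 < s" "v \<in> C" "\<tau> * s < v" for s v
  proof -
    have v: "0 < v" using that tau by (meson less_trans mult_pos_pos)
    have "(\<lambda>j. R (q j) * s) \<longlonglongrightarrow> \<tau> * s" by (intro tendsto_intros Rq)
    from order_tendstoD(2)[OF this that(4)]
    have ev: "eventually (\<lambda>j. k (q j) v \<le> k (q j) (R (q j) * s)) sequentially"
      by eventually_elim (use R that in \<open>auto intro!: k\<close>)
    show ?thesis
      by (rule tendsto_le[OF _ filterlim_compose[OF kg[OF that(1,2)] q]
            filterlim_compose[OF kh[OF that(3) v] q] ev]) simp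
  qed
  have le: "g s \<le> h v" if "s \<in> C" "0 < s" "v \<in> C" "0 < v" "v < \<tau> * s" for s v
  proof -
    have "(\<lambda>j. R (q j) * s) \<longlonglongrightarrow> \<tau> * s" by (intro tendsto_intros Rq)
    from order_tendstoD(1)[OF this that(5)]
    have ev: "eventually (\<lambda>j. k (q j) (R (q j) * s) \<le> k (q j) v) sequentially"
      by eventually_elim (use that in \<open>auto intro!: k\<close>)
    show ?thesis
      by (rule tendsto_le[OF _ filterlim_compose[OF kh[OF that(3,4)] q]
            filterlim_compose[OF kg[OF that(1,2)] q] ev]) simp
  qed
  have "g s = h (\<tau> * s)" if s: "0 < s" for s
  proof (rule antisym)
    show "g s \<le> h (\<tau> * s)"
    proof (rule left_limit_le[where h = h])
      show "(h \<longlongrightarrow> h (\<tau> * s)) (at_left (\<tau> * s))" using left_cont_tailD(3)[OF h] tau s by simp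
      fix u assume u: "0 < u" "u < \<tau> * s"
      obtain v where v: "v \<in> C" "u < v" "v < \<tau> * s"
        using dense_in_posD[OF C, of u "\<tau> * s"] u by auto
      have "v / \<tau> < s" "0 \<le> v / \<tau>" using v tau u by (auto simp: field_simps)
      then obtain s' where s': "s' \<in> C" "v / \<tau> < s'" "s' < s"
        using dense_in_posD[OF C, of "v/\<tau>" s] by auto
      have "0 < s'" using s' v u tau by (meson divide_pos_pos less_trans)
      have "g s \<le> g s'" using left_cont_tailD(1)[OF g] \<open>0 < s'\<close> s' by simp
      also have "g s' \<le> h v" using s' v u tau \<open>0 < s'\<close> by (intro le) (auto simp: field_simps)
      also have "h v \<le> h u" using left_cont_tailD(1)[OF h] u v by simp
      finally show "g s \<le> h u" .
    qed (use tau s in simp)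
    show "h (\<tau> * s) \<le> g s"
    proof (rule left_limit_le[where h = g])
      show "(g \<longlongrightarrow> g s) (at_left s)" using left_cont_tailD(3)[OF g] s by simp
      fix u assume u: "0 < u" "u < s"
      obtain s' where s': "s' \<in> C" "u < s'" "s' < s"
        using dense_in_posD[OF C, of u s] u by auto
      have "\<tau> * s' < \<tau> * s" "0 < \<tau> * s'" using s' tau u by auto
      then obtain v where v: "v \<in> C" "\<tau> * s' < v" "v < \<tau> * s"
        using dense_in_posD[OF C, of "\<tau> * s'" "\<tau> * s"] by auto
      have "h (\<tau> * s) \<le> h v" using left_cont_tailD(1)[OF h] v \<open>0 < \<tau> * s'\<close> by simp
      also have "\<dots> \<le> g s'" using s' v u by (intro ge) auto
      also have "\<dots> \<le> g u" using left_cont_tailD(1)[OF g] u s' by simp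
      finally show "h (\<tau> * s) \<le> g u" .
    qed (use s in simp)
  qed
  with tau show ?thesis using that by blast
qed

text \<open>The function agrees with the line of slope \<open>d / t\<close> at the multiples of \<open>t\<close>, and between two of
them a monotone function moves by at most \<open>d\<close>.\<close>

lemma quasi_periodic_near_line:
  fixes l :: "real \<Rightarrow> real"
  assumes "mono l" "0 < d" "\<And>u. l (u + t) = l u + d"
  shows "0 < t" "\<bar>l u - l 0 - d / t * u\<bar> \<le> d"
proof -
  show t: "0 < t"
  proof (rule ccontr)
    assume "\<not> 0 < t"
    then have "l (0 + t) \<le> l 0" using monoD[OF assms(1), of "0+t" 0] by simp
    then show False using assms(2) assms(3)[of 0] by simp
  qed
  have nat: "l (v + real n * t) = l v + real n * d" for v n
  proof (induction n)
    case (Suc n)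
    have "v + real (Suc n) * t = (v + real n * t) + t" by (simp add: algebra_simps)
    then show ?case using assms(3)[of "v + real n * t"] Suc by (simp add: algebra_simps)
  qed simp
  have int: "l (of_int i * t) = l 0 + of_int i * d" for i
  proof (cases "i \<ge> 0")
    case True
    then show ?thesis using nat[of 0 "nat i"] by simp
  next
    case False
    then show ?thesis using nat[of "of_int i * t" "nat (- i)"] by simp
  qed
  define i where "i = \<lfloor>u / t\<rfloor>"
  have i: "of_int i * t \<le> u" "u \<le> of_int (i + 1) * t"
    using t floor_divide_lower[OF t, of u] floor_divide_upper[OF t, of u] unfolding i_def by simp_all
  have "l 0 + of_int i * d \<le> l u" "l u \<le> l 0 + of_int (i+1) * d"
    using monoD[OF assms(1) i(1)] monoD[OF assms(1) i(2)] int[of i] int[of "i+1"] by simp_all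
  moreover have "of_int i * d \<le> d / t * u" "d / t * u \<le> of_int (i+1) * d"
    using mult_left_mono[OF i(1), of "d/t"] mult_left_mono[OF i(2), of "d/t"] t assms(2)
    by (simp_all add: field_simps)
  ultimately show "\<bar>l u - l 0 - d / t * u\<bar> \<le> d" by (simp add: algebra_simps abs_le_iff)
qed

text \<open>Each pair \<open>(d, t)\<close> keeps the function within bounded distance of a line. Two lines at bounded
distance from the same function have equal slopes, so there is a single line, and the distance to it is at most every
admissible \<open>d\<close>.\<close>

lemma mono_with_small_increments_affine:
  fixes l :: "real \<Rightarrow> real"
  assumes l: "mono l" and small: "\<And>e. 0 < e \<Longrightarrow> \<exists>d t. 0 < d \<and> d < e \<and> (\<forall>u. l (u + t) = l u + d)"
  obtains \<rho> where "0 < \<rho>" "\<And>u. l u = l 0 + \<rho> * u"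
proof -
  obtain d t where dt: "0 < d" "\<And>u. l (u + t) = l u + d" using small[of 1] by auto
  note near = quasi_periodic_near_line[OF l dt]
  define \<rho> where "\<rho> = d / t"
  have pos: "0 < \<rho>" using dt near(1) by (simp add: \<rho>_def)
  have slope: "d' / t' = \<rho>" if d': "0 < d'" "\<And>u. l (u + t') = l u + d'" for d' t'
  proof (rule ccontr)
    assume ne: "d' / t' \<noteq> \<rho>"
    define a where "a = \<bar>\<rho> - d' / t'\<bar>"
    have a: "a > 0" using ne by (simp add: a_def)
    \<comment> \<open>far enough out for lines with slopes differing by \<open>a\<close> to be more than \<open>d + d'\<close> apart\<close>
    define u where "u = (d + d' + 1) / a"
    have "\<bar>(\<rho> - d' / t') * u\<bar> \<le> d + d'"
      using near(2)[of u] quasi_periodic_near_line(2)[OF l d', of u]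
      by (simp add: \<rho>_def algebra_simps abs_le_iff)
    moreover have "\<bar>(\<rho> - d' / t') * u\<bar> = d + d' + 1"
      using a dt(1) d'(1) by (simp add: abs_mult u_def a_def[symmetric])
    ultimately show False by simp
  qed
  have "l u = l 0 + \<rho> * u" for u
  proof -
    have "\<bar>l u - l 0 - \<rho> * u\<bar> \<le> e" if e: "0 < e" for e
    proof -
      obtain d' t' where d': "0 < d'" "d' < e" "\<And>u. l (u + t') = l u + d'" using small[OF e] by auto
      show ?thesis using quasi_periodic_near_line(2)[OF l d'(1,3), of u] slope[OF d'(1,3)] d'(2) by simp
    qed
    from dense_ge[of 0, OF this] show ?thesis by simp
  qed
  with pos show ?thesis using that by blast
qed

text \<open>With \<open>l u = ln (- ln (h (exp u)))\<close> the hypothesis says that \<open>l (u + ln \<tau>) = l u + ln (a / c)\<close>. For \<open>l\<close>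
to be finite, \<open>h\<close> must lie strictly between 0 and 1 everywhere; squaring propagates this from \<open>s0\<close> to the geometric
progression \<open>\<tau> ^ n * s0\<close> in both directions.\<close>

lemma power_stable_tail:
  fixes h :: "real \<Rightarrow> real"
  assumes h: "left_cont_tail h" and le1: "\<And>s. 0 < s \<Longrightarrow> h s \<le> 1"
    and nd: "0 < s0" "0 < h s0" "h s0 < 1"
    and stable: "\<And>a c :: nat. 0 < a \<Longrightarrow> 0 < c \<Longrightarrow> \<exists>\<tau>>0. \<forall>s>0. h (\<tau> * s) = h s powr (real a / real c)"
  obtains \<rho> \<kappa> where "0 < \<rho>" "0 < \<kappa>" "\<And>s. 0 < s \<Longrightarrow> h s = exp (- (\<kappa> * s powr \<rho>))"
proof -
  note anti = left_cont_tailD(1)[OF h] and nonneg = left_cont_tailD(2)[OF h]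
  obtain \<tau> where tau: "0 < \<tau>" "\<And>s. 0 < s \<Longrightarrow> h (\<tau> * s) = h s powr 2"
    using stable[of 2 1] by auto
  have tau1: "1 < \<tau>"
  proof (rule ccontr)
    assume "\<not> 1 < \<tau>"
    then have "h s0 \<le> h (\<tau> * s0)" using tau(1) nd(1) by (intro anti) auto
    moreover have "h (\<tau> * s0) < h s0"
      using tau(2)[OF nd(1)] nd by (simp add: power2_eq_square)
    ultimately show False by simp
  qed
  have pos: "0 < h s" if s: "0 < s" for s
  proof -
    have *: "0 < h (\<tau> ^ n * s0)" for n
    proof (induction n)
      case (Suc n)
      have "h (\<tau> ^ Suc n * s0) = h (\<tau> ^ n * s0) powr 2"
        using tau(2)[of "\<tau> ^ n * s0"] nd tau(1) by (simp add: mult.assoc)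
      then show ?case using Suc by simp
    qed (use nd in simp)
    obtain n where n: "s / s0 < \<tau> ^ n" using real_arch_pow[OF tau1] by blast
    then have "s \<le> \<tau> ^ n * s0" using nd by (simp add: field_simps)
    then show ?thesis using anti[OF s] * less_le_trans by blast
  qed
  have lt1: "h s < 1" if s: "0 < s" for s
  proof -
    have *: "h (s0 / \<tau> ^ n) < 1" for n
    proof (induction n)
      case (Suc n)
      have "h (s0 / \<tau> ^ n) = h (s0 / \<tau> ^ Suc n) powr 2"
        using tau(2)[of "s0 / \<tau> ^ Suc n"] nd tau(1) by simp
      then have "h (s0 / \<tau> ^ Suc n) \<noteq> 1" using Suc by auto
      then show ?case using le1[of "s0 / \<tau> ^ Suc n"] nd tau(1) by simp
    qed (use nd in simp)
    obtain n where n: "s0 / s < \<tau> ^ n" using real_arch_pow[OF tau1] by blast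
    then have "s0 / \<tau> ^ n \<le> s" using nd s tau by (simp add: field_simps)
    then have "h s \<le> h (s0 / \<tau> ^ n)" using nd tau by (intro anti) auto
    then show ?thesis using *[of n] by simp
  qed
  define l where "l u = ln (- ln (h (exp u)))" for u
  have "mono l"
  proof (rule monoI)
    fix u v :: real assume "u \<le> v"
    then have "h (exp v) \<le> h (exp u)" by (intro anti) auto
    then have "ln (h (exp v)) \<le> ln (h (exp u))" using pos by simp
    moreover have "ln (h (exp u)) < 0" using pos lt1 by (simp add: ln_less_zero)
    ultimately show "l u \<le> l v" unfolding l_def by simp
  qed
  moreover have "\<exists>d t. 0 < d \<and> d < e \<and> (\<forall>u. l (u + t) = l u + d)" if e: "0 < e" for e
  proof -
    \<comment> \<open>the ratios \<open>(q + 1) / q\<close> are rational and their logarithms are arbitrarily small\<close>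
    obtain q :: nat where q: "q > 0" "1 / real q < e"
      using e real_arch_inverse[of e] by (auto simp: inverse_eq_divide)
    define d where "d = ln (real (q + 1) / real q)"
    have eq: "real (q + 1) / real q = 1 + 1 / real q" using q by (simp add: field_simps)
    have d: "0 < d" "d < e"
    proof -
      show "0 < d" unfolding d_def eq using q by (intro ln_gt_zero) auto
      have "d \<le> 1 / real q" unfolding d_def eq by (intro ln_add_one_self_le_self) auto
      then show "d < e" using q by simp
    qed
    obtain \<tau> where t: "0 < \<tau>" "\<And>s. 0 < s \<Longrightarrow> h (\<tau> * s) = h s powr (real (q + 1) / real q)"
      using stable[of "q+1" q] q by auto
    have "l (u + ln \<tau>) = l u + d" for u
    proof -
      have "h (exp (u + ln \<tau>)) = h (exp u) powr (real (q + 1) / real q)"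
        using t(2)[of "exp u"] t(1) by (simp add: exp_add mult.commute)
      then have "- ln (h (exp (u + ln \<tau>))) = (real (q + 1) / real q) * - ln (h (exp u))"
        using pos[of "exp u"] by (simp add: ln_powr)
      moreover have "- ln (h (exp u)) > 0" using pos lt1 by (simp add: ln_less_zero)
      moreover have "real (q + 1) / real q > 0" using q by simp
      ultimately show ?thesis unfolding l_def d_def by (simp only: ln_mult_pos add.commute)
    qed
    with d show ?thesis by blast
  qed
  ultimately obtain \<rho> where rho: "0 < \<rho>" "\<And>u. l u = l 0 + \<rho> * u"
    using mono_with_small_increments_affine by blast
  have "h s = exp (- (exp (l 0) * s powr \<rho>))" if s: "0 < s" for s
  proof -
    have neg: "- ln (h s) > 0" using pos[OF s] lt1[OF s] by (simp add: ln_less_zero)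
    then have "- ln (h s) = exp (l (ln s))" using s by (simp add: l_def)
    also have "\<dots> = exp (l 0) * s powr \<rho>"
      using s by (subst rho(2)) (simp add: exp_add powr_def)
    finally have "ln (h s) = - (exp (l 0) * s powr \<rho>)" by simp
    then show ?thesis using pos[OF s] by (metis exp_ln)
  qed
  then show ?thesis using that[of \<rho> "exp (l 0)"] rho(1) by simp
qed

lemma left_cont_tail_powr:
  assumes h: "left_cont_tail h" and r: "0 < r"
  shows "left_cont_tail (\<lambda>s. h s powr r)"
  unfolding left_cont_tail_def
proof (intro conjI allI impI)
  note D = left_cont_tailD[OF h]
  show "h t powr r \<le> h s powr r" if "0 < s \<and> s \<le> t" for s t
    using D(1)[of s t] D(2)[of t] that r by (intro powr_mono2) auto
  show "0 \<le> h s powr r" for s by simp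
  show "((\<lambda>s. h s powr r) \<longlongrightarrow> h s powr r) (at_left s)" if s: "0 < s" for s
  proof (intro tendsto_powr' D(3) tendsto_const disjI2 conjI)
    show "eventually (\<lambda>s. 0 \<le> h s) (at_left s)"
      using eventually_at_left_real[OF s] by eventually_elim (use D(2) in auto)
  qed (use s r in auto)
  show "\<exists>s>0. h s powr r < e" if e: "0 < e" for e
  proof -
    obtain s where s: "s > 0" "h s < e powr (1/r)" using D(4)[of "e powr (1/r)"] e by auto
    then have "h s powr r < (e powr (1/r)) powr r" using D(2) r by (intro powr_less_mono2) auto
    then show ?thesis using s e r by (auto simp: powr_powr)
  qed
  show "\<exists>s>0. 0 < h s powr r" using D(5) by auto
qed

text \<open>The subsequences \<open>a * j\<close> and \<open>c * j\<close> give two rescalings of one sequence: with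
\<open>p = 1 - V (b (c * j) * s)\<close>, the power \<open>p ^ (a * j)\<close> is \<open>(p ^ (c * j)) powr (a / c)\<close>. Its limit \<open>h s powr (a / c)\<close> and the
limit \<open>h\<close> along \<open>a * j\<close> are therefore of the same type. Indices \<open>Suc j\<close> keep the norming constants positive.\<close>

lemma limit_of_maxima_powerlaw:
  fixes V h :: "real \<Rightarrow> real" and b :: "nat \<Rightarrow> real"
  assumes V: "mono V" "\<And>s. 0 \<le> V s" "\<And>s. V s \<le> 1" and b: "\<And>n. 1 \<le> n \<Longrightarrow> 0 < b n"
    and C: "dense_in_pos C"
    and conv: "\<And>s. s \<in> C \<Longrightarrow> 0 < s \<Longrightarrow> (\<lambda>n. (1 - V (b n * s)) ^ n) \<longlonglongrightarrow> h s"
    and h: "left_cont_tail h" and le1: "\<And>s. 0 < s \<Longrightarrow> h s \<le> 1"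
    and nd: "0 < s0" "0 < h s0" "h s0 < 1"
  obtains \<rho> \<kappa> where "0 < \<rho>" "0 < \<kappa>" "\<And>s. 0 < s \<Longrightarrow> h s = exp (- (\<kappa> * s powr \<rho>))"
proof -
  have stable: "\<exists>\<tau>>0. \<forall>s>0. h (\<tau> * s) = h s powr (real a / real c)" if ac: "0 < a" "0 < c" for a c :: nat
  proof -
    define r where "r = real a / real c"
    have r: "0 < r" using ac by (simp add: r_def)
    define R where "R j = b (c * Suc j) / b (a * Suc j)" for j
    have bpos: "0 < b (c * Suc j)" "0 < b (a * Suc j)" for j using ac by (auto intro!: b)
    have sub: "filterlim (\<lambda>j. m * Suc j) at_top sequentially" if "0 < m" for m :: nat
      using that by (intro filterlim_subseq) (auto simp: strict_mono_def)
    obtain \<tau> where "0 < \<tau>" "\<And>s. 0 < s \<Longrightarrow> h s powr r = h (\<tau> * s)"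
    proof (rule convergence_of_types[of "\<lambda>j s. (1 - V (b (a * Suc j) * s)) ^ (a * Suc j)" R C h "\<lambda>s. h s powr r"])
      show "(1 - V (b (a * Suc j) * t)) ^ (a * Suc j) \<le> (1 - V (b (a * Suc j) * s)) ^ (a * Suc j)"
        if "0 < s" "s \<le> t" for j s t
        using that V(3) bpos(2)[of j] by (intro power_mono diff_left_mono monoD[OF V(1)]) auto
      show "0 < R j" for j unfolding R_def using bpos[of j] by simp
      show "(\<lambda>j. (1 - V (b (a * Suc j) * s)) ^ (a * Suc j)) \<longlonglongrightarrow> h s" if "s \<in> C" "0 < s" for s
        using filterlim_compose[OF conv[OF that] sub[OF ac(1)]] .
      show "(\<lambda>j. (1 - V (b (a * Suc j) * (R j * s))) ^ (a * Suc j)) \<longlonglongrightarrow> h s powr r"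
        if s: "s \<in> C" "0 < s" for s
      proof -
        have "(\<lambda>j. ((1 - V (b (c * Suc j) * s)) ^ (c * Suc j)) powr r) \<longlonglongrightarrow> h s powr r"
          using r V(3) by (intro tendsto_powr' filterlim_compose[OF conv[OF s] sub[OF ac(2)]] tendsto_const)
            (auto intro!: always_eventually)
        moreover have "((1 - V (b (c * Suc j) * s)) ^ (c * Suc j)) powr r
            = (1 - V (b (a * Suc j) * (R j * s))) ^ (a * Suc j)" for j
        proof -
          define p where "p = 1 - V (b (c * Suc j) * s)"
          have p: "0 \<le> p" using V(3) by (simp add: p_def)
          have "b (a * Suc j) * (R j * s) = b (c * Suc j) * s"
            using bpos[of j] by (simp add: R_def)
          moreover have "(p ^ (c * Suc j)) powr r = p ^ (a * Suc j)"
          proof (cases "p = 0")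
            case True
            then show ?thesis using ac by (simp add: zero_power)
          next
            case False
            then have "(p ^ (c * Suc j)) powr r = p powr (real (c * Suc j) * r)"
              using p by (simp add: powr_realpow[symmetric] powr_powr)
            also have "real (c * Suc j) * r = real (a * Suc j)"
              using ac by (simp add: r_def field_simps del: of_nat_Suc mult_Suc_right)
            finally show ?thesis using False p by (simp add: powr_realpow[symmetric])
          qed
          ultimately show ?thesis unfolding p_def by (simp only:)
        qed
        ultimately show ?thesis by (simp only:)
      qed
    qed (use C h left_cont_tail_powr[OF h r] in auto)
    then show ?thesis unfolding r_def by metis
  qed
  show ?thesis
  proof (rule power_stable_tail[of h s0])
    show "h s \<le> 1" if "0 < s" for s using that by (rule le1)
    show "\<exists>\<tau>>0. \<forall>s>0. h (\<tau> * s) = h s powr (real a / real c)" if "0 < a" "0 < c" for a c :: nat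
      using that by (rule stable)
    fix \<rho> \<kappa> assume "0 < \<rho>" "0 < \<kappa>" "\<And>s. 0 < s \<Longrightarrow> h s = exp (- (\<kappa> * s powr \<rho>))"
    then show thesis by (rule that)
  qed (fact h nd)+
qed

section \<open>Regular variation at zero\<close>

definition regvar_zero :: "(real \<Rightarrow> real) \<Rightarrow> real \<Rightarrow> bool" where
  "regvar_zero V \<rho> \<longleftrightarrow> (\<forall>z>0. ((\<lambda>u. V (u * z) / V u) \<longlongrightarrow> z powr \<rho>) (at_right 0))"

lemma exp_minus_le_quadratic:
  fixes v :: real
  assumes "0 \<le> v" "v \<le> 1"
  shows "exp (- v) - (1 - v) \<le> v\<^sup>2"
proof -
  have "1 + v \<le> exp v" by (rule exp_ge_add_one_self)
  then have "exp (- v) \<le> 1 / (1 + v)"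
    using assms by (simp add: exp_minus inverse_eq_divide frac_le)
  also have "\<dots> \<le> 1 - v + v\<^sup>2"
    using assms by (simp add: divide_simps power2_eq_square algebra_simps)
  finally show ?thesis by simp
qed

text \<open>Compare with \<open>exp (- v n) ^ n\<close>: the \<open>n\<close>-th powers differ by at most \<open>n * (v n)\<^sup>2\<close>, which is
\<open>(n * v n)\<^sup>2 / n\<close>.\<close>

lemma power_one_minus_tendsto_exp:
  fixes v :: "nat \<Rightarrow> real"
  assumes v: "\<And>n. 0 \<le> v n" "\<And>n. v n \<le> 1" and lim: "(\<lambda>n. real n * v n) \<longlonglongrightarrow> x"
  shows "(\<lambda>n. (1 - v n) ^ n) \<longlonglongrightarrow> exp (- x)"
proof -
  have bd: "\<bar>(1 - v n) ^ n - exp (- (real n * v n))\<bar> \<le> (real n * v n)\<^sup>2 / real n" for n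
  proof (cases "n = 0")
    case False
    have "\<bar>(1 - v n) ^ n - exp (- v n) ^ n\<bar> \<le> n * \<bar>(1 - v n) - exp (- v n)\<bar>"
      using norm_power_diff[of "1 - v n" "exp (- v n)" n] v[of n] by simp
    also have "\<bar>(1 - v n) - exp (- v n)\<bar> = exp (- v n) - (1 - v n)"
      using exp_ge_add_one_self[of "- v n"] by simp
    also have "n * \<dots> \<le> n * (v n)\<^sup>2"
      by (intro mult_left_mono exp_minus_le_quadratic v) simp
    also have "\<dots> = (real n * v n)\<^sup>2 / real n" using False by (simp add: power2_eq_square)
    finally show ?thesis by (simp add: exp_of_nat_mult[symmetric])
  qed simp
  have "(\<lambda>n. (real n * v n)\<^sup>2 / real n) \<longlonglongrightarrow> 0"
    by (intro tendsto_divide_0[OF tendsto_power[OF lim]] filterlim_at_top_imp_at_infinity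
        filterlim_real_sequentially)
  then have "(\<lambda>n. (1 - v n) ^ n - exp (- (real n * v n))) \<longlonglongrightarrow> 0"
    by (rule Lim_null_comparison[rotated]) (use bd in simp)
  from tendsto_add[OF this tendsto_exp[OF tendsto_minus[OF lim]]] show ?thesis by simp
qed

text \<open>Taking logarithms, \<open>n * ln (1 - v n)\<close> tends to \<open>- x\<close>, which forces \<open>v n\<close> to 0; then \<open>v n\<close> lies between
\<open>- ln (1 - v n) * (1 - v n)\<close> and \<open>- ln (1 - v n)\<close>.\<close>

lemma power_one_minus_tendsto_exp_converse:
  fixes v :: "nat \<Rightarrow> real"
  assumes v: "\<And>n. 0 \<le> v n" "\<And>n. v n \<le> 1" and lim: "(\<lambda>n. (1 - v n) ^ n) \<longlonglongrightarrow> exp (- x)"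
  shows "(\<lambda>n. real n * v n) \<longlonglongrightarrow> x"
proof -
  have ev: "eventually (\<lambda>n. 0 < (1 - v n) ^ n \<and> 0 < n) sequentially"
    using order_tendstoD(1)[OF lim exp_gt_zero] eventually_gt_at_top[of "0::nat"] by eventually_elim auto
  have pos: "eventually (\<lambda>n. 0 < 1 - v n \<and> 0 < n) sequentially"
    using ev
  proof eventually_elim
    case (elim n)
    have "1 - v n \<noteq> 0" using elim by (auto simp: zero_power)
    then show ?case using v(2)[of n] elim by simp
  qed
  have "(\<lambda>n. ln ((1 - v n) ^ n)) \<longlonglongrightarrow> - x" using tendsto_ln[OF lim] by simp
  then have L: "(\<lambda>n. real n * ln (1 - v n)) \<longlonglongrightarrow> - x"
    by (rule Lim_transform_eventually)
       (rule eventually_mono[OF pos], simp add: ln_realpow)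
  have "(\<lambda>n. (real n * ln (1 - v n)) / real n) \<longlonglongrightarrow> 0"
    by (intro tendsto_divide_0[OF L] filterlim_at_top_imp_at_infinity filterlim_real_sequentially)
  then have l0: "(\<lambda>n. ln (1 - v n)) \<longlonglongrightarrow> 0"
    by (rule Lim_transform_eventually) (rule eventually_mono[OF pos], simp)
  have "(\<lambda>n. exp (ln (1 - v n))) \<longlonglongrightarrow> 1" using tendsto_exp[OF l0] by simp
  then have one: "(\<lambda>n. 1 - v n) \<longlonglongrightarrow> 1"
    by (rule Lim_transform_eventually) (rule eventually_mono[OF pos], simp)
  have up: "(\<lambda>n. - (real n * ln (1 - v n))) \<longlonglongrightarrow> x" using tendsto_minus[OF L] by simp
  have lo: "(\<lambda>n. - (real n * ln (1 - v n)) * (1 - v n)) \<longlonglongrightarrow> x"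
    using tendsto_mult[OF up one] by simp
  show ?thesis
  proof (rule tendsto_sandwich[OF _ _ lo up])
    show "eventually (\<lambda>n. - (real n * ln (1 - v n)) * (1 - v n) \<le> real n * v n) sequentially"
      using pos
    proof eventually_elim
      case (elim n)
      have "ln (1 / (1 - v n)) \<le> 1 / (1 - v n) - 1" using elim by (intro ln_le_minus_one) simp
      then have "- ln (1 - v n) * (1 - v n) \<le> v n" using elim by (simp add: ln_div field_simps)
      from mult_left_mono[OF this, of "real n"] show ?case by (simp add: algebra_simps)
    qed
    show "eventually (\<lambda>n. real n * v n \<le> - (real n * ln (1 - v n))) sequentially"
      using pos
    proof eventually_elim
      case (elim n)
      have "ln (1 - v n) \<le> - v n" using ln_le_minus_one[of "1 - v n"] elim by simp
      from mult_left_mono[OF this, of "real n"] show ?case by simp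
    qed
  qed
qed

lemma tendsto_zero_of_mult_nat:
  fixes v :: "nat \<Rightarrow> real"
  assumes "(\<lambda>n. real n * v n) \<longlonglongrightarrow> x"
  shows "v \<longlonglongrightarrow> 0"
proof -
  have "(\<lambda>n. (real n * v n) / real n) \<longlonglongrightarrow> 0"
    by (intro tendsto_divide_0[OF assms] filterlim_at_top_imp_at_infinity filterlim_real_sequentially)
  then show ?thesis
    by (rule Lim_transform_eventually) (rule eventually_mono[OF eventually_gt_at_top[of "0::nat"]], simp)
qed

lemma scale_tendsto_zero:
  fixes V :: "real \<Rightarrow> real"
  assumes V: "mono V" "\<And>s. 0 < s \<Longrightarrow> 0 < V s" and a: "eventually (\<lambda>n. 0 < a n) sequentially"
    and lim: "(\<lambda>n. V (a n)) \<longlonglongrightarrow> 0"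
  shows "filterlim a (at_right 0) sequentially"
proof (rule tendsto_imp_filterlim_at_right[OF _ a], rule order_tendstoI)
  fix e :: real assume "0 < e"
  from order_tendstoD(2)[OF lim V(2)[OF this]]
  show "eventually (\<lambda>n. a n < e) sequentially"
  proof eventually_elim
    case (elim n)
    then show ?case using monoD[OF V(1), of e "a n"] by linarith
  qed
qed (use a in \<open>auto elim!: eventually_mono\<close>)

lemma tail_tendsto_zero:
  fixes V :: "real \<Rightarrow> real"
  assumes V: "mono V" "\<And>s. 0 < s \<Longrightarrow> 0 < V s"
    and small: "\<And>e. 0 < e \<Longrightarrow> \<exists>u>0. V u < e"
  shows "(V \<longlongrightarrow> 0) (at_right 0)"
proof (rule order_tendstoI)
  fix e :: real assume "0 < e"
  then obtain u where u: "u > 0" "V u < e" using small by blast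
  show "eventually (\<lambda>v. V v < e) (at_right 0)"
    using eventually_at_right_real[OF u(1)]
  proof eventually_elim
    case (elim v)
    then show ?case using monoD[OF V(1), of v u] u(2) by auto
  qed
next
  fix e :: real assume "e < 0"
  show "eventually (\<lambda>v. e < V v) (at_right 0)"
    using eventually_at_right_less[of 0]
  proof eventually_elim
    case (elim v)
    then show ?case using V(2)[of v] \<open>e < 0\<close> by linarith
  qed
qed

lemma floor_inverse_asymp:
  fixes V :: "real \<Rightarrow> real"
  assumes V: "(V \<longlongrightarrow> 0) F" "eventually (\<lambda>u. 0 < V u) F"
  shows "filterlim (\<lambda>u. nat \<lfloor>1 / V u\<rfloor>) at_top F"
    and "((\<lambda>u. real (nat \<lfloor>1 / V u\<rfloor>) * V u) \<longlongrightarrow> 1) F"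
proof -
  have inv: "filterlim (\<lambda>u. inverse (V u)) at_top F"
    using V by (intro filterlim_inverse_at_top) auto
  show "filterlim (\<lambda>u. nat \<lfloor>1 / V u\<rfloor>) at_top F"
    using filterlim_compose[OF filterlim_nat_sequentially
        filterlim_compose[OF filterlim_floor_sequentially inv]]
    by (simp add: inverse_eq_divide)
  have lo: "((\<lambda>u. 1 - V u) \<longlongrightarrow> 1) F" using tendsto_diff[OF tendsto_const V(1), of 1] by simp
  show "((\<lambda>u. real (nat \<lfloor>1 / V u\<rfloor>) * V u) \<longlongrightarrow> 1) F"
  proof (rule tendsto_sandwich[OF _ _ lo tendsto_const])
    show "eventually (\<lambda>u. 1 - V u \<le> real (nat \<lfloor>1 / V u\<rfloor>) * V u) F"
      using V(2)
    proof eventually_elim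
      case (elim u)
      have "1 / V u - 1 \<le> real (nat \<lfloor>1 / V u\<rfloor>)" using elim by linarith
      from mult_right_mono[OF this, of "V u"] show ?case using elim by (simp add: algebra_simps)
    qed
    show "eventually (\<lambda>u. real (nat \<lfloor>1 / V u\<rfloor>) * V u \<le> 1) F"
      using V(2)
    proof eventually_elim
      case (elim u)
      have "0 \<le> 1 / V u" using elim by simp
      then have "real (nat \<lfloor>1 / V u\<rfloor>) \<le> 1 / V u" by linarith
      from mult_right_mono[OF this, of "V u"] show ?case using elim by simp
    qed
  qed
qed

text \<open>For small \<open>u\<close> the index \<open>N u\<close> is chosen from \<open>u\<close> itself, as
the integer part of \<open>1 / V u\<close>, so that \<open>N u * V u\<close> tends to 1 and \<open>V (u * z) / V u\<close> behaves like
\<open>N u * V (u * z)\<close>. Comparing \<open>V u\<close> with \<open>V (b (N u) * s)\<close> locates \<open>u / b (N u)\<close>.\<close>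

lemma regvar_zero_of_sequence:
  fixes V :: "real \<Rightarrow> real" and b :: "nat \<Rightarrow> real"
  assumes V: "mono V" "\<And>s. 0 < s \<Longrightarrow> 0 < V s" and b: "\<And>n. 1 \<le> n \<Longrightarrow> 0 < b n"
    and pos: "0 < \<rho>" "0 < \<kappa>"
    and lim: "\<And>s. 0 < s \<Longrightarrow> (\<lambda>n. real n * V (b n * s)) \<longlonglongrightarrow> \<kappa> * s powr \<rho>"
  shows "regvar_zero V \<rho>"
  unfolding regvar_zero_def
proof (intro allI impI)
  fix z :: real assume z: "0 < z"
  have b0: "(\<lambda>n. V (b n * 1)) \<longlonglongrightarrow> 0" using tendsto_zero_of_mult_nat[OF lim[of 1]] by simp
  have V0: "(V \<longlongrightarrow> 0) (at_right 0)"
  proof (rule tail_tendsto_zero[OF V])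
    fix e :: real assume "0 < e"
    then have "eventually (\<lambda>n. V (b n * 1) < e \<and> 1 \<le> n) sequentially"
      using order_tendstoD(2)[OF b0] eventually_ge_at_top[of 1] by (intro eventually_conj) auto
    then obtain n where "V (b n) < e" "1 \<le> n" by (auto dest!: eventually_happens)
    then show "\<exists>u>0. V u < e" using b by blast
  qed
  define N where "N u = nat \<lfloor>1 / V u\<rfloor>" for u
  have Vpos: "eventually (\<lambda>u. 0 < V u) (at_right 0)"
    using eventually_at_right_less[of 0] by eventually_elim (rule V(2))
  have N: "filterlim N at_top (at_right 0)" "((\<lambda>u. real (N u) * V u) \<longlongrightarrow> 1) (at_right 0)"
    unfolding N_def using floor_inverse_asymp[OF V0 Vpos] by auto
  have limN: "((\<lambda>u. real (N u) * V (b (N u) * s)) \<longlongrightarrow> \<kappa> * s powr \<rho>) (at_right 0)" if "0 < s" for s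
    using filterlim_compose[OF lim[OF that] N(1)] .
  \<comment> \<open>the limit of \<open>u / b (N u)\<close>\<close>
  define c where "c = (1 / \<kappa>) powr (1 / \<rho>)"
  have c: "0 < c" "\<kappa> * c powr \<rho> = 1" using pos by (simp_all add: c_def powr_powr)
  have cz: "\<kappa> * (c * z) powr \<rho> = z powr \<rho>"
    using c z by (simp add: powr_mult)
  have cont: "((\<lambda>s. \<kappa> * (s * z) powr \<rho>) \<longlongrightarrow> z powr \<rho>) (at c)"
    using c z by (subst cz[symmetric]) (intro tendsto_intros, auto)
  have NV: "((\<lambda>u. real (N u) * V (u * z)) \<longlongrightarrow> z powr \<rho>) (at_right 0)"
  proof (rule order_tendstoI)
    fix y assume y: "y < z powr \<rho>"
    have "eventually (\<lambda>s. y < \<kappa> * (s * z) powr \<rho> \<and> s \<in> {0<..<c}) (at_left c)"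
      using order_tendstoD(1)[OF filterlim_mono[OF cont order_refl at_le, of "{..<c}"] y]
        eventually_at_left_real[OF c(1)] by (auto intro: eventually_conj)
    then obtain s where s: "y < \<kappa> * (s * z) powr \<rho>" "0 < s" "s < c"
      by (auto dest!: eventually_happens)
    have "\<kappa> * s powr \<rho> < 1"
      using mult_strict_left_mono[OF powr_less_mono2[OF pos(1) _ s(3)] pos(2)] s(2) c(2) by simp
    then obtain q where q: "\<kappa> * s powr \<rho> < q" "q < 1" using dense by blast
    have "0 < s * z" using s z by simp
    show "eventually (\<lambda>u. y < real (N u) * V (u * z)) (at_right 0)"
      using order_tendstoD(2)[OF limN[OF s(2)] q(1)] order_tendstoD(1)[OF N(2) q(2)]
        order_tendstoD(1)[OF limN[OF \<open>0 < s * z\<close>] s(1)]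
    proof eventually_elim
      case (elim u)
      have "V (b (N u) * s) < V u" using elim(1,2)
        by (meson less_trans mult_left_less_imp_less of_nat_0_le_iff)
      then have "b (N u) * s \<le> u" using monoD[OF V(1)] by (meson not_le less_imp_le)
      then have "V (b (N u) * (s * z)) \<le> V (u * z)"
        using z by (intro monoD[OF V(1)]) (simp add: mult.assoc[symmetric])
      then have "real (N u) * V (b (N u) * (s * z)) \<le> real (N u) * V (u * z)"
        by (intro mult_left_mono) auto
      then show ?case using elim(3) by simp
    qed
  next
    fix y assume y: "z powr \<rho> < y"
    have "c < c + 1" by simp
    have "eventually (\<lambda>s. \<kappa> * (s * z) powr \<rho> < y \<and> s \<in> {c<..<c+1}) (at_right c)"
      using order_tendstoD(2)[OF filterlim_mono[OF cont order_refl at_le, of "{c<..}"] y]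
        eventually_at_right_real[OF \<open>c < c + 1\<close>] by (auto intro: eventually_conj)
    then obtain s where s: "\<kappa> * (s * z) powr \<rho> < y" "c < s"
      by (auto dest!: eventually_happens)
    have s0: "0 < s" using s c by simp
    have "1 < \<kappa> * s powr \<rho>"
      using mult_strict_left_mono[OF powr_less_mono2[OF pos(1) _ s(2)] pos(2)] c by simp
    then obtain q where q: "1 < q" "q < \<kappa> * s powr \<rho>" using dense by blast
    have "0 < s * z" using s0 z by simp
    show "eventually (\<lambda>u. real (N u) * V (u * z) < y) (at_right 0)"
      using order_tendstoD(1)[OF limN[OF s0] q(2)] order_tendstoD(2)[OF N(2) q(1)]
        order_tendstoD(2)[OF limN[OF \<open>0 < s * z\<close>] s(1)]
    proof eventually_elim
      case (elim u)
      have "V u < V (b (N u) * s)" using elim(1,2)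
        by (meson less_trans mult_left_less_imp_less of_nat_0_le_iff)
      then have "u \<le> b (N u) * s" using monoD[OF V(1)] by (meson not_le less_imp_le)
      then have "V (u * z) \<le> V (b (N u) * (s * z))"
        using z by (intro monoD[OF V(1)]) (simp add: mult.assoc[symmetric])
      then have "real (N u) * V (u * z) \<le> real (N u) * V (b (N u) * (s * z))"
        by (intro mult_left_mono) auto
      then show ?case using elim(3) by simp
    qed
  qed
  have quot: "((\<lambda>u. (real (N u) * V (u * z)) / (real (N u) * V u)) \<longlongrightarrow> z powr \<rho> / 1) (at_right 0)"
    by (intro tendsto_divide NV N(2)) simp
  have "eventually (\<lambda>u. 0 < N u) (at_right 0)"
    by (rule eventually_compose_filterlim[OF eventually_gt_at_top N(1)])
  then have "eventually (\<lambda>u. (real (N u) * V (u * z)) / (real (N u) * V u) = V (u * z) / V u) (at_right 0)"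
    by eventually_elim simp
  from Lim_transform_eventually[OF quot this]
  show "((\<lambda>u. V (u * z) / V u) \<longlongrightarrow> z powr \<rho>) (at_right 0)" by simp
qed

text \<open>The ratio \<open>V (2 * u) / V u\<close> tends to \<open>2 powr \<rho>\<close>; half the index leaves room for an inequality.\<close>

lemma regvar_zero_doubling:
  fixes V :: "real \<Rightarrow> real"
  assumes V: "\<And>s. 0 < s \<Longrightarrow> 0 < V s" and rho: "0 < \<rho>" and rv: "regvar_zero V \<rho>"
  shows "\<exists>u0>0. \<forall>u. 0 < u \<and> u \<le> u0 \<longrightarrow> 2 powr (\<rho>/2) * V u \<le> V (2 * u)"
proof -
  have lim: "((\<lambda>u. V (u * 2) / V u) \<longlongrightarrow> 2 powr \<rho>) (at_right 0)"
    using rv unfolding regvar_zero_def by simp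
  have "2 powr (\<rho>/2) < (2::real) powr \<rho>" using rho by simp
  from order_tendstoD(1)[OF lim this] obtain w where w: "w > 0"
    "\<And>u. 0 < u \<Longrightarrow> u < w \<Longrightarrow> 2 powr (\<rho>/2) < V (u * 2) / V u"
    unfolding eventually_at_right_field by blast
  show ?thesis
  proof (intro exI[of _ "w/2"] conjI allI impI)
    fix u assume u: "0 < u \<and> u \<le> w/2"
    have "2 powr (\<rho>/2) < V (u * 2) / V u" using u w(1) by (intro w(2)) auto
    then show "2 powr (\<rho>/2) * V u \<le> V (2 * u)"
      using V[of u] u by (simp add: pos_less_divide_eq mult.commute)
  qed (use w(1) in simp)
qed

lemma regvar_zero_iterated_doubling:
  fixes V :: "real \<Rightarrow> real"
  assumes dbl: "\<And>u. 0 < u \<Longrightarrow> u \<le> u0 \<Longrightarrow> 2 powr (\<rho>/2) * V u \<le> V (2 * u)"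
    and u: "0 < u" "2 ^ k * u \<le> u0"
  shows "(2 ^ k) powr (\<rho>/2) * V u \<le> V (2 ^ k * u)"
  using u(2)
proof (induction k)
  case (Suc k)
  have le: "2 ^ k * u \<le> u0" 
  proof -
    have "2 * (2 ^ k * u) \<le> u0" using Suc.prems by (simp add: mult.assoc)
    moreover have "0 < 2 ^ k * u" using u(1) by simp
    ultimately show ?thesis by linarith
  qed
  have "(2 ^ Suc k) powr (\<rho>/2) * V u = 2 powr (\<rho>/2) * ((2 ^ k) powr (\<rho>/2) * V u)"
    by (simp add: powr_mult)
  also have "\<dots> \<le> 2 powr (\<rho>/2) * V (2 ^ k * u)"
    using Suc.IH[OF le] by (intro mult_left_mono) auto
  also have "\<dots> \<le> V (2 * (2 ^ k * u))" using u le by (intro dbl) auto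
  finally show ?case by (simp add: mult.assoc)
qed simp

text \<open>Halving the argument divides \<open>V\<close> by a factor bounded away from 1.\<close>

lemma regvar_zero_tendsto_zero:
  fixes V :: "real \<Rightarrow> real"
  assumes V: "mono V" "\<And>s. 0 < s \<Longrightarrow> 0 < V s" and rho: "0 < \<rho>" and rv: "regvar_zero V \<rho>"
  shows "(V \<longlongrightarrow> 0) (at_right 0)"
proof (rule tail_tendsto_zero[OF V])
  fix e :: real assume e: "0 < e"
  obtain u0 where u0: "0 < u0" "\<And>u. 0 < u \<Longrightarrow> u \<le> u0 \<Longrightarrow> 2 powr (\<rho>/2) * V u \<le> V (2 * u)"
    using regvar_zero_doubling[OF V(2) rho rv] by auto
  have "1 < (2::real) powr (\<rho>/2)" using rho by simp
  then obtain k where k: "V u0 / e < (2 powr (\<rho>/2)) ^ k" using real_arch_pow by blast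
  have "(2 ^ k) powr (\<rho>/2) * V (u0 / 2 ^ k) \<le> V (2 ^ k * (u0 / 2 ^ k))"
    by (rule regvar_zero_iterated_doubling[of u0]) (use u0 in auto)
  moreover have "(2 ^ k) powr (\<rho>/2) = (2 powr (\<rho>/2) :: real) ^ k"
    by (simp add: powr_realpow[symmetric] powr_powr mult.commute)
  ultimately have "(2 powr (\<rho>/2)) ^ k * V (u0 / 2 ^ k) \<le> V u0" by simp
  also have "\<dots> < (2 powr (\<rho>/2)) ^ k * e" using k e by (simp add: field_simps)
  finally have "V (u0 / 2 ^ k) < e" by (simp add: mult_less_cancel_left_pos)
  then show "\<exists>u>0. V u < e" using u0(1) by (intro exI[of _ "u0 / 2 ^ k"]) auto
qed

text \<open>A Potter bound. Below \<open>u0\<close> it follows by iterated doubling. For \<open>u * s\<close> between \<open>u0\<close> and \<open>B\<close>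
monotonicity reduces it to the point \<open>u0\<close>, at the cost of the constant factor \<open>(u0 / B) powr (\<rho> / 2)\<close>.\<close>

lemma regvar_zero_lower_bound:
  fixes V :: "real \<Rightarrow> real"
  assumes V: "mono V" "\<And>s. 0 < s \<Longrightarrow> 0 < V s" and rho: "0 < \<rho>" and rv: "regvar_zero V \<rho>"
    and B: "0 < B"
  shows "\<exists>c>0. \<exists>u0>0. \<forall>u s. 0 < u \<and> u \<le> u0 \<and> 1 \<le> s \<and> u * s \<le> B \<longrightarrow>
           c * s powr (\<rho>/2) * V u \<le> V (u * s)"
proof -
  obtain u0 where u0: "0 < u0" "\<And>u. 0 < u \<Longrightarrow> u \<le> u0 \<Longrightarrow> 2 powr (\<rho>/2) * V u \<le> V (2 * u)"
    using regvar_zero_doubling[OF V(2) rho rv] by auto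
  have near: "(s/2) powr (\<rho>/2) * V u \<le> V (u * s)" if u: "0 < u" "1 \<le> s" "u * s \<le> u0" for u s
  proof -
    obtain k where k: "2 ^ k \<le> s" "s < 2 ^ (k+1)"
    proof -
      have "\<exists>m. s < 2 ^ m" using real_arch_pow[of 2 s] by auto
      define m where "m = (LEAST m. s < 2 ^ m)"
      have m: "s < 2 ^ m" unfolding m_def using \<open>\<exists>m. _\<close> by (rule LeastI_ex)
      have "m \<noteq> 0" using m u(2) by (intro notI) simp
      then obtain k where "m = Suc k" using not0_implies_Suc by blast
      moreover have "\<not> s < 2 ^ k" using not_less_Least[of k "\<lambda>m. s < 2 ^ m"] \<open>m = Suc k\<close>
        unfolding m_def by simp
      ultimately show ?thesis using that[of k] m by simp
    qed
    have ks: "2 ^ k * u \<le> u * s" using k u by (simp add: mult.commute)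
    have "(s/2) powr (\<rho>/2) * V u \<le> (2 ^ k) powr (\<rho>/2) * V u"
      using k u rho V(2)[OF u(1)] by (intro mult_right_mono powr_mono2) auto
    also have "\<dots> \<le> V (2 ^ k * u)"
    proof (rule regvar_zero_iterated_doubling[of u0])
      show "2 powr (\<rho>/2) * V w \<le> V (2 * w)" if "0 < w" "w \<le> u0" for w
        using that by (rule u0(2))
      show "2 ^ k * u \<le> u0" using ks u(3) by linarith
    qed (rule u(1))
    also have "\<dots> \<le> V (u * s)" by (intro monoD[OF V(1)] ks)
    finally show ?thesis .
  qed
  define c where "c = min ((1/2) powr (\<rho>/2)) ((u0 / (2 * B)) powr (\<rho>/2))"
  have c: "0 < c" "c \<le> (1/2) powr (\<rho>/2)" "c \<le> (u0 / (2 * B)) powr (\<rho>/2)"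
    unfolding c_def using u0(1) B by simp_all
  have bound: "c * s powr (\<rho>/2) * V u \<le> V (u * s)"
    if u: "0 < u" "u \<le> u0" "1 \<le> s" "u * s \<le> B" for u s
  proof (cases "u * s \<le> u0")
    case True
    have "c * s powr (\<rho>/2) * V u \<le> (1/2) powr (\<rho>/2) * s powr (\<rho>/2) * V u"
      using c V(2)[OF u(1)] by (intro mult_right_mono) auto
    also have "\<dots> = (s/2) powr (\<rho>/2) * V u" using u powr_mult[of "1/2" s "\<rho>/2"] by simp
    also have "\<dots> \<le> V (u * s)" using near True u by simp
    finally show ?thesis .
  next
    case False
    have uu: "1 \<le> u0 / u" using u by simp
    have "s \<le> B / u" using u by (simp add: field_simps)
    then have s: "(u0 / (2 * B)) * s \<le> (u0 / u) / 2"
      using mult_left_mono[of s "B / u" "u0 / (2 * B)"] B u0(1) by simp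
    have "c * s powr (\<rho>/2) * V u \<le> (u0 / (2 * B)) powr (\<rho>/2) * s powr (\<rho>/2) * V u"
      using c V(2)[OF u(1)] by (intro mult_right_mono) auto
    also have "\<dots> = ((u0 / (2 * B)) * s) powr (\<rho>/2) * V u" by (simp only: powr_mult)
    also have "\<dots> \<le> ((u0 / u) / 2) powr (\<rho>/2) * V u"
      using s u0(1) B u rho V(2)[OF u(1)] by (intro mult_right_mono powr_mono2) auto
    also have "\<dots> \<le> V (u * (u0 / u))" using u uu by (intro near) auto
    also have "\<dots> \<le> V (u * s)" using False u by (intro monoD[OF V(1)]) simp
    finally show ?thesis .
  qed
  show ?thesis
    by (intro exI[of _ c] exI[of _ u0] conjI allI impI c(1) u0(1)) (elim conjE, rule bound)
qed

text \<open>The level \<open>1 / n\<close> lies between \<open>V (a n * z)\<close> for \<open>z < 1\<close> and for \<open>z > 1\<close>; divided by \<open>V (a n)\<close> these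
two bounds tend to \<open>z powr \<rho>\<close>, which is close to 1.\<close>

lemma regvar_zero_quantile_scale:
  fixes V :: "real \<Rightarrow> real" and a :: "nat \<Rightarrow> real"
  assumes V: "mono V" "\<And>s. 0 < s \<Longrightarrow> 0 < V s" and rho: "0 < \<rho>" and rv: "regvar_zero V \<rho>"
    and ev: "eventually (\<lambda>n. 0 < a n \<and> (\<forall>s. 0 < s \<and> s < a n \<longrightarrow> V s \<le> 1 / real n) \<and>
                              (\<forall>s>a n. 1 / real n \<le> V s)) sequentially"
    and s: "0 < s"
  shows "(\<lambda>n. real n * V (a n * s)) \<longlonglongrightarrow> s powr \<rho>"
proof -
  have "eventually (\<lambda>n. 0 < a n) sequentially" using ev by eventually_elim simp
  then have half: "eventually (\<lambda>n. 0 < a n / 2) sequentially" by eventually_elim simp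
  have inv0: "(\<lambda>n. 1 / real n) \<longlonglongrightarrow> 0" by (rule lim_1_over_n)
  have "(\<lambda>n. V (a n / 2)) \<longlonglongrightarrow> 0"
  proof (rule tendsto_sandwich[OF _ _ tendsto_const inv0])
    show "eventually (\<lambda>n. 0 \<le> V (a n / 2)) sequentially"
      using half by eventually_elim (rule less_imp_le[OF V(2)])
    show "eventually (\<lambda>n. V (a n / 2) \<le> 1 / real n) sequentially"
      using ev by eventually_elim auto
  qed
  from scale_tendsto_zero[OF V half this]
  have "filterlim (\<lambda>n. a n / 2) (at_right 0) sequentially" .
  then have "(\<lambda>n. 2 * (a n / 2)) \<longlonglongrightarrow> 2 * 0"
    by (intro tendsto_mult tendsto_const) (simp add: filterlim_at)
  then have a0: "filterlim a (at_right 0) sequentially"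
    using ev by (intro tendsto_imp_filterlim_at_right) (auto elim!: eventually_mono)
  have ratio: "(\<lambda>n. V (a n * z) / V (a n)) \<longlonglongrightarrow> z powr \<rho>" if "0 < z" for z
    using filterlim_compose[OF _ a0, of "\<lambda>u. V (u * z) / V u"] rv that
    unfolding regvar_zero_def by auto
  have one: "(\<lambda>n. (1 / real n) / V (a n)) \<longlonglongrightarrow> 1"
  proof (rule order_tendstoI)
    fix y :: real assume y: "y < 1"
    have c: "((\<lambda>z. z powr \<rho>) \<longlongrightarrow> 1 powr \<rho>) (at_left 1)" by (intro tendsto_intros) auto
    have "eventually (\<lambda>z. y < z powr \<rho> \<and> z \<in> {0<..<1}) (at_left (1::real))"
      using order_tendstoD(1)[OF c, of y] y eventually_at_left_real[of 0 1]
      by (auto intro: eventually_conj)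
    then obtain z where z: "y < z powr \<rho>" "0 < z" "z < 1" by (auto dest!: eventually_happens)
    show "eventually (\<lambda>n. y < (1 / real n) / V (a n)) sequentially"
      using ev order_tendstoD(1)[OF ratio[OF z(2)] z(1)]
    proof eventually_elim
      case (elim n)
      have "V (a n * z) \<le> 1 / real n" using elim z by simp
      then have "V (a n * z) / V (a n) \<le> (1 / real n) / V (a n)"
        using V(2)[of "a n"] elim by (intro divide_right_mono) auto
      then show ?case using elim by linarith
    qed
  next
    fix y :: real assume y: "1 < y"
    have c: "((\<lambda>z. z powr \<rho>) \<longlongrightarrow> 1 powr \<rho>) (at_right 1)" by (intro tendsto_intros) auto
    have "eventually (\<lambda>z. z powr \<rho> < y \<and> z \<in> {1<..<2}) (at_right (1::real))"
      using order_tendstoD(2)[OF c, of y] y eventually_at_right_real[of 1 2]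
      by (auto intro: eventually_conj)
    then obtain z where z: "z powr \<rho> < y" "1 < z" by (auto dest!: eventually_happens)
    have "0 < z" using z by simp
    show "eventually (\<lambda>n. (1 / real n) / V (a n) < y) sequentially"
      using ev order_tendstoD(2)[OF ratio[OF \<open>0 < z\<close>] z(1)]
    proof eventually_elim
      case (elim n)
      have "1 / real n \<le> V (a n * z)" using elim z by simp
      then have "(1 / real n) / V (a n) \<le> V (a n * z) / V (a n)"
        using V(2)[of "a n"] elim by (intro divide_right_mono) auto
      then show ?case using elim by linarith
    qed
  qed
  have "(\<lambda>n. (V (a n * s) / V (a n)) / ((1 / real n) / V (a n))) \<longlonglongrightarrow> s powr \<rho> / 1"
    by (intro tendsto_divide ratio[OF s] one) simp
  then have "(\<lambda>n. (V (a n * s) / V (a n)) / ((1 / real n) / V (a n))) \<longlonglongrightarrow> s powr \<rho>" by simp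
  then show ?thesis
  proof (rule Lim_transform_eventually)
    show "eventually (\<lambda>n. (V (a n * s) / V (a n)) / ((1 / real n) / V (a n)) = real n * V (a n * s)) sequentially"
      using ev
    proof eventually_elim
      case (elim n)
      then have "V (a n) > 0" using V(2) by blast
      then show ?case by simp
    qed
  qed
qed

section \<open>Moments\<close>

text \<open>Write \<open>w ^ k\<close> as the integral of its derivative over \<open>[0, w]\<close> and exchange the integrals.\<close>

lemma (in sigma_finite_measure) nn_integral_power_tail:
  fixes W :: "'a \<Rightarrow> real" and k :: nat
  assumes W [measurable]: "W \<in> borel_measurable M" and nonneg: "AE x in M. 0 \<le> W x" and k: "1 \<le> k"
  shows "(\<integral>\<^sup>+x. ennreal (W x ^ k) \<partial>M) =
    (\<integral>\<^sup>+s. ennreal (real k * s ^ (k - 1)) * indicator {0..} s * emeasure M {x\<in>space M. s \<le> W x} \<partial>lborel)"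
proof -
  interpret P: pair_sigma_finite M lborel by unfold_locales
  define f where "f x s = ennreal (real k * s ^ (k - 1)) * (if 0 \<le> s \<and> s \<le> W x then 1 else 0)" for x s
  have power: "ennreal (w ^ k) = (\<integral>\<^sup>+s. ennreal (real k * s ^ (k - 1)) * indicator {0..w} s \<partial>lborel)"
    if "0 \<le> w" for w :: real
  proof -
    have "(\<integral>\<^sup>+s. ennreal (real k * s ^ (k - 1)) * indicator {0..w} s \<partial>lborel) = ennreal (w ^ k - 0 ^ k)"
      using that by (intro nn_integral_FTC_Icc) (auto intro!: derivative_eq_intros)
    then show ?thesis using k by (simp add: zero_power)
  qed
  have "(\<integral>\<^sup>+x. ennreal (W x ^ k) \<partial>M) = (\<integral>\<^sup>+x. (\<integral>\<^sup>+s. f x s \<partial>lborel) \<partial>M)"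
  proof (rule nn_integral_cong_AE)
    show "AE x in M. ennreal (W x ^ k) = (\<integral>\<^sup>+s. f x s \<partial>lborel)"
      using nonneg
    proof eventually_elim
      case (elim x)
      show ?case unfolding power[OF elim] f_def
        by (intro nn_integral_cong) (simp add: indicator_def)
    qed
  qed
  also have "\<dots> = (\<integral>\<^sup>+s. (\<integral>\<^sup>+x. f x s \<partial>M) \<partial>lborel)"
    by (rule P.Fubini'[symmetric]) (simp add: f_def)
  also have "\<dots> = (\<integral>\<^sup>+s. ennreal (real k * s ^ (k - 1)) * indicator {0..} s *
      emeasure M {x\<in>space M. s \<le> W x} \<partial>lborel)"
  proof (rule nn_integral_cong)
    fix s :: real
    have "(\<integral>\<^sup>+x. f x s \<partial>M) = (\<integral>\<^sup>+x. (ennreal (real k * s ^ (k - 1)) * indicator {0..} s) *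
        indicator {x\<in>space M. s \<le> W x} x \<partial>M)"
      by (intro nn_integral_cong) (simp add: f_def indicator_def)
    also have "\<dots> = ennreal (real k * s ^ (k - 1)) * indicator {0..} s * emeasure M {x\<in>space M. s \<le> W x}"
      by (rule nn_integral_cmult_indicator) measurable
    finally show "(\<integral>\<^sup>+x. f x s \<partial>M) = \<dots>" .
  qed
  finally show ?thesis .
qed

text \<open>If \<open>x\<close> is exponentially distributed, then \<open>x powr (1 / \<rho>)\<close> has tail \<open>exp (- (s powr \<rho>))\<close>. Its \<open>k\<close>-th
moment is Euler's integral for the gamma function, so the tail formula for moments replaces a change of variables.\<close>

lemma weibull_moment:
  fixes \<rho> :: real and k :: nat
  assumes rho: "0 < \<rho>" and k: "1 \<le> k"
  shows "(\<integral>\<^sup>+s. ennreal (real k * s ^ (k - 1)) * indicator {0..} s * ennreal (exp (- (s powr \<rho>))) \<partial>lborel)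
    = ennreal (Gamma (1 + real k / \<rho>))"
proof -
  define E where "E = density lborel (\<lambda>x. ennreal (exponential_density 1 x))"
  interpret E: prob_space E unfolding E_def by (rule prob_space_exponential_density) simp
  define W where "W x = x powr (1 / \<rho>)" for x :: real
  have W_meas: "W \<in> borel_measurable E" unfolding W_def E_def by simp
  have tail: "emeasure E {x\<in>space E. s \<le> W x} = ennreal (exp (- (s powr \<rho>)))" if s: "0 \<le> s" for s
  proof -
    have "emeasure E {x\<in>space E. s \<le> W x} =
        (\<integral>\<^sup>+x. ennreal (exponential_density 1 x) * indicator {x. s \<le> W x} x \<partial>lborel)"
      unfolding E_def W_def by (subst emeasure_density) auto
    also have "\<dots> = (\<integral>\<^sup>+x. ennreal (exp (- x)) * indicator {s powr \<rho>..} x \<partial>lborel)"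
    proof (rule nn_integral_cong)
      fix x :: real
      show "ennreal (exponential_density 1 x) * indicator {x. s \<le> W x} x =
          ennreal (exp (- x)) * indicator {s powr \<rho>..} x"
      proof (cases "x < 0")
        case True
        have "0 \<le> s powr \<rho>" by simp
        then have "x < s powr \<rho>" using True by linarith
        then have "x \<notin> {s powr \<rho>..}" using True by (simp add: not_le)
        then show ?thesis using True by (simp add: exponential_density_def)
      next
        case False
        have "s \<le> x powr (1 / \<rho>) \<longleftrightarrow> s powr \<rho> \<le> x"
        proof
          assume "s \<le> x powr (1 / \<rho>)"
          then have "s powr \<rho> \<le> (x powr (1 / \<rho>)) powr \<rho>" using s rho by (intro powr_mono2) auto
          then show "s powr \<rho> \<le> x" using False rho by (simp add: powr_powr)
        next
          assume "s powr \<rho> \<le> x"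
          then have "(s powr \<rho>) powr (1 / \<rho>) \<le> x powr (1 / \<rho>)" using rho by (intro powr_mono2) auto
          then show "s \<le> x powr (1 / \<rho>)" using s rho by (simp add: powr_powr)
        qed
        then show ?thesis using False by (simp add: exponential_density_def W_def indicator_def)
      qed
    qed
    also have "\<dots> = ennreal (0 - (- exp (- (s powr \<rho>))))"
    proof (rule nn_integral_FTC_atLeast)
      show "((\<lambda>x. - exp (- x)) \<longlongrightarrow> 0) (at_top :: real filter)"
        using tendsto_minus[OF filterlim_compose[OF exp_at_bot filterlim_uminus_at_bot_at_top]] by simp
    qed (auto intro!: derivative_eq_intros)
    finally show ?thesis by simp
  qed
  have "ennreal (Gamma (1 + real k / \<rho>)) =
      (\<integral>\<^sup>+x. ennreal (indicator {0..} x * x powr (1 + real k / \<rho> - 1) / exp x) \<partial>lborel)"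
    using rho by (intro Gamma_conv_nn_integral_real) (simp add: add_pos_nonneg)
  also have "\<dots> = (\<integral>\<^sup>+x. ennreal (exponential_density 1 x) * ennreal (W x ^ k) \<partial>lborel)"
  proof (rule nn_integral_cong)
    fix x :: real
    show "ennreal (indicator {0..} x * x powr (1 + real k / \<rho> - 1) / exp x) =
        ennreal (exponential_density 1 x) * ennreal (W x ^ k)"
    proof (cases "x \<le> 0")
      case True
      then show ?thesis using k rho
        by (cases "x = 0") (auto simp: exponential_density_def W_def zero_power)
    next
      case False
      then have "W x ^ k = x powr (real k / \<rho>)"
        by (simp add: W_def powr_realpow[symmetric] powr_powr)
      then show ?thesis using False
        by (simp add: exponential_density_def exp_minus ennreal_mult'[symmetric] field_simps)
    qed
  qed
  also have "\<dots> = (\<integral>\<^sup>+x. ennreal (W x ^ k) \<partial>E)"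
    unfolding E_def by (subst nn_integral_density) (auto simp: W_def)
  also have "\<dots> = (\<integral>\<^sup>+s. ennreal (real k * s ^ (k - 1)) * indicator {0..} s *
      emeasure E {x\<in>space E. s \<le> W x} \<partial>lborel)"
    by (rule E.nn_integral_power_tail[OF W_meas _ k]) (simp add: W_def)
  also have "\<dots> = (\<integral>\<^sup>+s. ennreal (real k * s ^ (k - 1)) * indicator {0..} s *
      ennreal (exp (- (s powr \<rho>))) \<partial>lborel)"
    by (intro nn_integral_cong) (simp add: tail split: split_indicator)
  finally show ?thesis by simp
qed

text \<open>From \<open>y ^ N \<le> exp (N * y)\<close> with \<open>N\<close> so large that \<open>\<beta> * N \<ge> k\<close>.\<close>

lemma stretched_exp_le_inverse_power:
  fixes c \<beta> :: real and k :: nat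
  assumes "0 < c" "0 < \<beta>"
  obtains D where "0 \<le> D" "\<And>s. 1 \<le> s \<Longrightarrow> exp (- (c * s powr \<beta>)) \<le> D / s ^ k"
proof -
  obtain N :: nat where N: "real k / \<beta> < real N" using reals_Archimedean2 by blast
  have N0: "0 < N" using N assms by (cases N) (auto simp: field_simps not_less)
  have kN: "real k \<le> \<beta> * real N" using N assms by (simp add: field_simps)
  define D where "D = (real N / c) ^ N"
  have "exp (- (c * s powr \<beta>)) \<le> D / s ^ k" if s: "1 \<le> s" for s
  proof -
    define y where "y = c * s powr \<beta> / real N"
    have y: "0 < y" using assms s N0 by (simp add: y_def)
    have "y ^ N \<le> exp y ^ N"
      using y exp_ge_add_one_self[of y] by (intro power_mono) linarith+
    also have "exp y ^ N = exp (c * s powr \<beta>)"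
      using N0 by (simp add: exp_of_nat_mult[symmetric] y_def)
    finally have "exp (- (c * s powr \<beta>)) \<le> 1 / y ^ N"
      using y by (simp add: exp_minus inverse_eq_divide frac_le)
    also have "1 / y ^ N = D / s powr (\<beta> * real N)"
      using assms s N0 by (simp add: y_def D_def power_divide power_mult_distrib powr_realpow[symmetric] powr_powr)
    also have "\<dots> \<le> D / s powr real k"
      using s kN assms by (intro divide_left_mono powr_mono) (auto simp: D_def)
    also have "s powr real k = s ^ k" using s by (simp add: powr_realpow)
    finally show ?thesis .
  qed
  moreover have "0 \<le> D" using assms by (simp add: D_def)
  ultimately show ?thesis using that by blast
qed

lemma nn_integral_inverse_square:
  fixes D :: real
  assumes "0 \<le> D"
  shows "(\<integral>\<^sup>+s. ennreal (D / s\<^sup>2) * indicator {1..} s \<partial>lborel) = ennreal D"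
proof -
  have "(\<integral>\<^sup>+s. ennreal (D / s\<^sup>2) * indicator {1..} s \<partial>lborel) = ennreal (0 - (- D / 1))"
  proof (rule nn_integral_FTC_atLeast)
    show "((\<lambda>s. - D / s) has_real_derivative D / s\<^sup>2) (at s)" if "1 \<le> s" for s
      using that by (auto intro!: derivative_eq_intros simp: power2_eq_square)
    show "((\<lambda>s. - D / s) \<longlongrightarrow> 0) at_top"
      by (intro tendsto_divide_0[OF tendsto_const] filterlim_at_top_imp_at_infinity filterlim_ident)
  qed (use assms in auto)
  then show ?thesis by simp
qed

text \<open>Dominated convergence in the tail formula: \<open>k * s ^ (k - 1)\<close> times the tail is at most \<open>k\<close> on
\<open>[0, 1]\<close> and at most a multiple of \<open>1 / s\<^sup>2\<close> beyond.\<close>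

lemma (in prob_space) moments_converge_to_weibull:
  fixes W :: "nat \<Rightarrow> 'a \<Rightarrow> real" and k :: nat
  assumes W [measurable]: "\<And>n. W n \<in> borel_measurable M" and nonneg: "\<And>n. AE x in M. 0 \<le> W n x"
    and rho: "0 < \<rho>" and c: "0 < c" "0 < \<beta>" and k: "1 \<le> k"
    and lim: "\<And>s. 0 < s \<Longrightarrow> (\<lambda>n. prob {x\<in>space M. s \<le> W n x}) \<longlonglongrightarrow> exp (- (s powr \<rho>))"
    and dom: "eventually (\<lambda>n. \<forall>s\<ge>1. prob {x\<in>space M. s \<le> W n x} \<le> exp (- (c * s powr \<beta>))) sequentially"
  shows "(\<lambda>n. expectation (\<lambda>x. W n x ^ k)) \<longlonglongrightarrow> Gamma (1 + real k / \<rho>)"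
proof -
  obtain N where N: "\<And>n s. N \<le> n \<Longrightarrow> 1 \<le> s \<Longrightarrow> prob {x\<in>space M. s \<le> W n x} \<le> exp (- (c * s powr \<beta>))"
    using dom unfolding eventually_sequentially by blast
  obtain D where D: "0 \<le> D" "\<And>s. 1 \<le> s \<Longrightarrow> exp (- (c * s powr \<beta>)) \<le> D / s ^ (k + 1)"
    using stretched_exp_le_inverse_power[OF c] by metis
  define u where "u n s = ennreal (real k * s ^ (k - 1)) * indicator {0..} s *
    emeasure M {x\<in>space M. s \<le> W (n + N) x}" for n and s :: real
  define u' where "u' s = ennreal (real k * s ^ (k - 1)) * indicator {0..} s * ennreal (exp (- (s powr \<rho>)))" for s :: real
  define w where "w s = ennreal (real k) * indicator {0..1} s + ennreal (real k * D / s\<^sup>2) * indicator {1..} s" for s :: real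
  have "(\<lambda>n. \<integral>\<^sup>+s. u n s \<partial>lborel) \<longlonglongrightarrow> (\<integral>\<^sup>+s. u' s \<partial>lborel)"
  proof (rule nn_integral_dominated_convergence[where w = w])
    show "u n \<in> borel_measurable lborel" for n unfolding u_def by measurable
    show "u' \<in> borel_measurable lborel" unfolding u'_def by measurable
    show "w \<in> borel_measurable lborel" unfolding w_def by measurable
    show "AE s in lborel. u n s \<le> w s" for n
    proof (rule AE_I2)
      fix s :: real
      consider "s < 0" | "0 \<le> s" "s \<le> 1" | "1 < s" by linarith
      then show "u n s \<le> w s"
      proof cases
        case 1
        then show ?thesis by (simp add: u_def)
      next
        case 2
        have "u n s \<le> ennreal (real k * s ^ (k - 1)) * 1"
          unfolding u_def using 2 by (simp add: emeasure_eq_measure mult_left_le)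
        also have "\<dots> \<le> ennreal (real k)"
          using 2 by (simp add: mult_left_le power_le_one ennreal_leI)
        also have "\<dots> \<le> w s" unfolding w_def using 2 by simp
        finally show ?thesis .
      next
        case 3
        have "u n s \<le> ennreal (real k * s ^ (k - 1)) * ennreal (D / s ^ (k + 1))"
          unfolding u_def using 3 D(2)[of s]
          by (simp add: emeasure_eq_measure) (intro mult_left_mono ennreal_leI order_trans[OF N]; simp)
        also have "\<dots> = ennreal (real k * s ^ (k - 1) * (D / s ^ (k + 1)))"
          using 3 D(1) by (simp add: ennreal_mult'[symmetric])
        also have "real k * s ^ (k - 1) * (D / s ^ (k + 1)) = real k * D / s\<^sup>2"
        proof -
          have "s ^ (k + 1) = s ^ (k - 1) * s\<^sup>2" using k by (simp add: power_add[symmetric])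
          then show ?thesis using 3 by simp
        qed
        also have "ennreal \<dots> \<le> w s" unfolding w_def using 3 by simp
        finally show ?thesis .
      qed
    qed
    have "(\<integral>\<^sup>+s. w s \<partial>lborel) = ennreal (real k) + ennreal (real k * D)"
      unfolding w_def using D(1)
      by (subst nn_integral_add) (auto simp: nn_integral_cmult_indicator nn_integral_inverse_square)
    then show "(\<integral>\<^sup>+s. w s \<partial>lborel) < \<infinity>" by simp
    show "AE s in lborel. (\<lambda>n. u n s) \<longlonglongrightarrow> u' s"
    proof (rule AE_mp[OF AE_lborel_singleton[of 0]], rule AE_I2, rule impI)
      fix s :: real assume "s \<noteq> 0"
      show "(\<lambda>n. u n s) \<longlonglongrightarrow> u' s"
      proof (cases "0 < s")
        case True
        have ind: "indicator {0..} s = (1 :: ennreal)" using True by simp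
        show ?thesis unfolding u_def u'_def emeasure_eq_measure ind
          using LIMSEQ_ignore_initial_segment[OF lim[OF True], of N]
          by (intro ennreal_tendsto_cmult tendsto_ennrealI) auto
      next
        case False
        then show ?thesis using \<open>s \<noteq> 0\<close> by (simp add: u_def u'_def)
      qed
    qed
  qed
  also have "(\<lambda>n. \<integral>\<^sup>+s. u n s \<partial>lborel) = (\<lambda>n. \<integral>\<^sup>+x. ennreal (W (n + N) x ^ k) \<partial>M)"
    unfolding u_def using nn_integral_power_tail[OF W nonneg k] by simp
  also have "(\<integral>\<^sup>+s. u' s \<partial>lborel) = ennreal (Gamma (1 + real k / \<rho>))"
    unfolding u'_def by (rule weibull_moment[OF rho k])
  finally have "(\<lambda>n. enn2real (\<integral>\<^sup>+x. ennreal (W (n + N) x ^ k) \<partial>M)) \<longlonglongrightarrow> enn2real (ennreal (Gamma (1 + real k / \<rho>)))"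
    by (intro tendsto_enn2real) auto
  moreover have "enn2real (\<integral>\<^sup>+x. ennreal (W n x ^ k) \<partial>M) = expectation (\<lambda>x. W n x ^ k)" for n
    using nonneg[of n] by (intro integral_eq_nn_integral[symmetric]) (auto elim!: eventually_mono)
  moreover have "0 < Gamma (1 + real k / \<rho>)" using rho by (intro Gamma_real_pos) (simp add: add_pos_nonneg)
  ultimately have "(\<lambda>n. expectation (\<lambda>x. W (n + N) x ^ k)) \<longlonglongrightarrow> Gamma (1 + real k / \<rho>)" by simp
  then show ?thesis by (rule LIMSEQ_offset)
qed

text \<open>This is the positivity of the variance of the Weibull law. It is strict midpoint convexity of
\<open>ln_Gamma\<close> on \<open>[1, 1 + 2 * a]\<close>, because its derivative is strictly increasing, together with \<open>ln_Gamma 1 = 0\<close>.\<close>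

lemma Gamma_square_less:
  fixes a :: real
  assumes a: "0 < a"
  shows "(Gamma (1 + a))\<^sup>2 < Gamma (1 + 2 * a)"
proof -
  have D: "(ln_Gamma has_real_derivative Digamma x) (at x)" if "1 \<le> x" for x :: real
    using that by (intro has_field_derivative_ln_Gamma_real) simp
  obtain p where p: "1 < p" "p < 1 + a" "ln_Gamma (1 + a) - ln_Gamma 1 = (1 + a - 1) * Digamma p"
    using MVT2[of 1 "1 + a" ln_Gamma Digamma] a D by auto
  obtain q where q: "1 + a < q" "q < 1 + 2 * a"
    "ln_Gamma (1 + 2 * a) - ln_Gamma (1 + a) = (1 + 2 * a - (1 + a)) * Digamma q"
    using MVT2[of "1 + a" "1 + 2 * a" ln_Gamma Digamma] a D by auto
  have "Digamma p < Digamma q" using p q by (intro Digamma_real_strict_mono) auto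
  then have "a * Digamma p < a * Digamma q" using a by simp
  moreover have "ln_Gamma (1::real) = 0" by (simp add: ln_Gamma_real_pos)
  ultimately have "2 * ln_Gamma (1 + a) < ln_Gamma (1 + 2 * a)"
    using p(3) q(3) by simp
  then have "exp (ln_Gamma (1 + a) + ln_Gamma (1 + a)) < exp (ln_Gamma (1 + 2 * a))" by simp
  moreover have "0 < 1 + a" "0 < 1 + 2 * a" using a by simp_all
  ultimately show ?thesis by (simp only: exp_add Gamma_real_pos_exp power2_eq_square)
qed

section \<open>Distribution functions on the real line\<close>

lemma monotone_limit_at_moving_point:
  fixes F :: "nat \<Rightarrow> real \<Rightarrow> real" and G :: "real \<Rightarrow> real"
  assumes F: "\<And>n. mono (F n)" and lim: "\<And>y. (\<lambda>n. F n y) \<longlonglongrightarrow> G y"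
    and G: "isCont G y" and y: "ys \<longlonglongrightarrow> y"
  shows "(\<lambda>n. F n (ys n)) \<longlonglongrightarrow> G y"
proof (rule order_tendstoI)
  have cont: "(G \<longlongrightarrow> G y) (at y)" using G by (simp add: isCont_def)
  fix c assume c: "c < G y"
  have "eventually (\<lambda>z. c < G z \<and> z \<in> {y - 1<..<y}) (at_left y)"
    using order_tendstoD(1)[OF filterlim_mono[OF cont order_refl at_le, of "{..<y}"] c]
      eventually_at_left_real[of "y - 1" y] by (auto intro: eventually_conj)
  then obtain z where z: "c < G z" "z < y" by (auto dest!: eventually_happens)
  show "eventually (\<lambda>n. c < F n (ys n)) sequentially"
    using order_tendstoD(1)[OF lim z(1)] order_tendstoD(1)[OF y z(2)]
  proof eventually_elim
    case (elim n)
    then show ?case using monoD[OF F, of z "ys n" n] by linarith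
  qed
next
  have cont: "(G \<longlongrightarrow> G y) (at y)" using G by (simp add: isCont_def)
  fix c assume c: "G y < c"
  have "eventually (\<lambda>z. G z < c \<and> z \<in> {y<..<y + 1}) (at_right y)"
    using order_tendstoD(2)[OF filterlim_mono[OF cont order_refl at_le, of "{y<..}"] c]
      eventually_at_right_real[of y "y + 1"] by (auto intro: eventually_conj)
  then obtain z where z: "G z < c" "y < z" by (auto dest!: eventually_happens)
  show "eventually (\<lambda>n. F n (ys n) < c) sequentially"
    using order_tendstoD(2)[OF lim z(1)] order_tendstoD(2)[OF y z(2)]
  proof eventually_elim
    case (elim n)
    then show ?case using monoD[OF F, of "ys n" z n] by linarith
  qed
qed

lemma isCont_Psi:
  assumes "0 < \<rho>"
  shows "isCont (Psi \<rho>) y"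
proof -
  have "Psi \<rho> = (\<lambda>y. exp (- (max 0 (- y) powr \<rho>)))"
    using assms by (auto simp: Psi_def fun_eq_iff max_def)
  moreover have "isCont (\<lambda>y. exp (- (max 0 (- y) powr \<rho>))) y"
    unfolding isCont_def using assms
    by (intro tendsto_intros tendsto_powr') (auto intro!: always_eventually)
  ultimately show ?thesis by simp
qed

lemma Psi_distribution_function:
  assumes rho: "0 < \<rho>"
  shows "distribution_function (Psi \<rho>)"
proof -
  have mono: "Psi \<rho> y \<le> Psi \<rho> z" if "y \<le> z" for y z
    using that rho by (auto simp: Psi_def intro!: powr_mono2)
  have right: "continuous (at_right y) (Psi \<rho>)" for y
    using isCont_Psi[OF rho] continuous_at_imp_continuous_at_within by blast
  have bot: "(Psi \<rho> \<longlongrightarrow> 0) at_bot"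
  proof -
    have "filterlim (\<lambda>x. exp (\<rho> * ln x)) at_top at_top"
      by (intro filterlim_compose[OF exp_at_top] filterlim_tendsto_pos_mult_at_top[OF tendsto_const rho] ln_at_top)
    then have "filterlim (\<lambda>x. x powr \<rho>) at_top at_top"
      by (rule filterlim_mono_eventually)
         (auto simp: powr_def intro: eventually_mono[OF eventually_gt_at_top[of 0]])
    then have "filterlim (\<lambda>y. (- y) powr \<rho>) at_top at_bot"
      by (rule filterlim_compose[OF _ filterlim_uminus_at_top_at_bot])
    then have "((\<lambda>y. exp (- ((- y) powr \<rho>))) \<longlongrightarrow> 0) at_bot"
      by (intro filterlim_compose[OF exp_at_bot] filterlim_compose[OF filterlim_uminus_at_bot_at_top])
    then show ?thesis
      by (rule Lim_transform_eventually)
         (rule eventually_mono[OF eventually_le_at_bot[of "-1"]], simp add: Psi_def)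
  qed
  have top: "(Psi \<rho> \<longlongrightarrow> 1) at_top"
    by (rule Lim_transform_eventually[OF tendsto_const])
       (rule eventually_mono[OF eventually_ge_at_top[of 0]], simp add: Psi_def)
  show ?thesis unfolding distribution_function_def
    using real_distribution_interval_measure[OF mono right bot top]
      cdf_interval_measure[OF mono right bot] by metis
qed

lemma Psi_nondegenerate:
  assumes rho: "0 < \<rho>"
  shows "\<not> degenerate_df (Psi \<rho>)"
proof
  assume "degenerate_df (Psi \<rho>)"
  then obtain a where "Psi \<rho> = indicator {a..}" unfolding degenerate_df_def by blast
  then have "Psi \<rho> (-1) = 0 \<or> Psi \<rho> (-1) = 1" by (simp add: indicator_def)
  then show False by (simp add: Psi_def)
qed

text \<open>A distribution function with values in \<open>{0, 1}\<close> jumps at the infimum of the set where it is 1, and right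
continuity makes it the indicator of a closed half-line.\<close>

lemma nondegenerate_df_intermediate:
  assumes G: "distribution_function G" "\<not> degenerate_df G"
  obtains y where "0 < G y" "G y < 1"
proof (rule ccontr)
  assume no: "\<not> thesis"
  obtain \<mu> where mu: "real_distribution \<mu>" "G = cdf \<mu>" using G(1) unfolding distribution_function_def by blast
  interpret real_distribution \<mu> by (rule mu(1))
  have bounds: "0 \<le> G y" "G y \<le> 1" for y unfolding mu(2) by (rule cdf_nonneg, rule cdf_bounded_prob)
  have mono: "G y \<le> G z" if "y \<le> z" for y z unfolding mu(2) using that by (rule cdf_nondecreasing)
  have zero_one: "G y = 0 \<or> G y = 1" for y
    using no that[of y] bounds[of y] by linarith
  define S where "S = {y. G y = 1}"
  have "eventually (\<lambda>y. 0 < G y) at_top"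
    unfolding mu(2) by (rule order_tendstoD(1)[OF cdf_lim_at_top_prob]) simp
  then obtain y1 where "0 < G y1" by (auto dest!: eventually_happens)
  then have ne: "S \<noteq> {}" using zero_one[of y1] by (auto simp: S_def)
  have "eventually (\<lambda>y. G y < 1) at_bot"
    unfolding mu(2) by (rule order_tendstoD(2)[OF cdf_lim_at_bot]) simp
  then obtain y0 where y0: "G y0 < 1" by (auto dest!: eventually_happens)
  have low: "y0 \<le> s" if "s \<in> S" for s
    using mono[of s y0] y0 that by (force simp: S_def)
  then have bdd: "bdd_below S" unfolding bdd_below_def by blast
  define a where "a = Inf S"
  have above: "G y = 1" if y: "a < y" for y
  proof -
    obtain s where "s \<in> S" "s < y" using cInf_lessD[OF ne, of y] y unfolding a_def by blast
    then have "1 \<le> G y" using mono[of s y] by (simp add: S_def)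
    then show ?thesis using bounds(2)[of y] by simp
  qed
  have below: "G y = 0" if "y < a" for y
  proof -
    have "y \<notin> S" using cInf_lower[OF _ bdd, of y] that unfolding a_def by auto
    then show ?thesis using zero_one[of y] by (simp add: S_def)
  qed
  have "(G \<longlongrightarrow> G a) (at_right a)"
    using cdf_is_right_cont[of a] unfolding mu(2) by (simp add: continuous_within)
  moreover have "(G \<longlongrightarrow> 1) (at_right a)"
    by (rule Lim_transform_eventually[OF tendsto_const])
       (use eventually_at_right_less[of a] in \<open>eventually_elim, simp add: above\<close>)
  ultimately have "G a = 1" using tendsto_unique trivial_limit_at_right_real by blast
  then have "G = indicator {a..}"
    using above below by (force simp: fun_eq_iff indicator_def not_le le_less)
  then show False using G(2) unfolding degenerate_df_def by blast
qed

lemma reflected_df_left_cont_tail: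
  assumes mu: "real_distribution \<mu>" and y: "y < 0" "0 < cdf \<mu> y"
  shows "left_cont_tail (\<lambda>s. cdf \<mu> (- s))"
proof -
  interpret real_distribution \<mu> by (rule mu)
  show ?thesis unfolding left_cont_tail_def
  proof (intro conjI allI impI)
    show "cdf \<mu> (- t) \<le> cdf \<mu> (- s)" if "0 < s \<and> s \<le> t" for s t
      using that by (intro cdf_nondecreasing) simp
    show "0 \<le> cdf \<mu> (- s)" for s by (rule cdf_nonneg)
    show "((\<lambda>s. cdf \<mu> (- s)) \<longlongrightarrow> cdf \<mu> (- s)) (at_left s)" for s
      using cdf_is_right_cont[of "- s"] by (simp add: filterlim_at_left_to_right continuous_within)
    show "\<exists>s>0. cdf \<mu> (- s) < e" if e: "0 < e" for e
    proof -
      have "eventually (\<lambda>z. cdf \<mu> z < e \<and> z < 0) at_bot"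
        using order_tendstoD(2)[OF cdf_lim_at_bot e] eventually_le_at_bot[of "-1::real"]
        by eventually_elim simp
      then obtain z where "cdf \<mu> z < e" "z < 0" by (auto dest!: eventually_happens)
      then show ?thesis by (intro exI[of _ "- z"]) simp
    qed
    show "\<exists>s>0. 0 < cdf \<mu> (- s)" using y by (intro exI[of _ "- y"]) simp
  qed
qed

lemma reflected_df_continuity_dense:
  assumes mu: "real_distribution \<mu>"
  shows "dense_in_pos {s. isCont (cdf \<mu>) (- s)}"
  unfolding dense_in_pos_def
proof (intro allI impI)
  interpret real_distribution \<mu> by (rule mu)
  fix a b :: real assume ab: "0 < a \<and> a < b"
  have "mono (cdf \<mu>)" by (intro monoI cdf_nondecreasing)
  then have "countable {y. \<not> isCont (cdf \<mu>) y}" by (rule mono_ctble_discont)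
  moreover have "-b < -a" using ab by simp
  ultimately obtain y where "y \<in> {-b<..<-a}" "y \<notin> {y. \<not> isCont (cdf \<mu>) y}"
    using real_interval_avoid_countable_set by blast
  then show "\<exists>s\<in>{s. isCont (cdf \<mu>) (- s)}. a < s \<and> s < b" by (intro bexI[of _ "- y"]) auto
qed

section \<open>The law of the estimator\<close>

locale frontier_sample = prob_space M
  for M :: "'a measure" +
  fixes X :: "'a \<Rightarrow> real ^ 'p" and Y :: "'a \<Rightarrow> real"
    and Xs :: "nat \<Rightarrow> 'a \<Rightarrow> real ^ 'p" and Ys :: "nat \<Rightarrow> 'a \<Rightarrow> real"
    and x :: "real ^ 'p"
  assumes X_meas [measurable]: "X \<in> borel_measurable M" and Y_meas [measurable]: "Y \<in> borel_measurable M"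
    and Y_nonneg: "\<And>\<omega>. \<omega> \<in> space M \<Longrightarrow> 0 \<le> Y \<omega>"
    and indep: "indep_vars (\<lambda>_. borel) (\<lambda>i \<omega>. (Xs i \<omega>, Ys i \<omega>)) UNIV"
    and same: "\<And>i. distr M borel (\<lambda>\<omega>. (Xs i \<omega>, Ys i \<omega>)) = distr M borel (\<lambda>\<omega>. (X \<omega>, Y \<omega>))"
    and marg_pos: "0 < marginal_df M X x"
    and bdd: "bdd_above (frontier_set M X Y x)"
begin

definition exceed :: "real \<Rightarrow> real" where
  "exceed y = prob {\<omega> \<in> space M. X \<omega> \<le> x \<and> y < Y \<omega>}"

abbreviation m :: real where "m \<equiv> marginal_df M X x"
abbreviation \<phi> :: real where "\<phi> \<equiv> frontier_fun M X Y x"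
abbreviation est :: "nat \<Rightarrow> 'a \<Rightarrow> real" where "est n \<equiv> fdh Xs Ys n x"

text \<open>The mass of an observation within \<open>s\<close> below the frontier. Measuring the distance from the frontier turns the
upper tail of \<open>Y\<close> into a function that increases from 0 at 0, and keeping the factor \<open>F\<^sub>X x\<close> makes \<open>n * V s\<close>
an expected number of observations.\<close>

definition V :: "real \<Rightarrow> real" where "V s = exceed (\<phi> - s)"

lemma X_le_sets [measurable]: "{\<omega> \<in> space M. X \<omega> \<le> x} \<in> sets M"
proof -
  have "{..x} \<in> sets borel" by (intro borel_closed closed_eucl_atMost)
  from measurable_sets[OF X_meas this] show ?thesis by (simp add: vimage_def Int_def conj_commute)
qed

lemma exceed_sets [measurable]: "{\<omega> \<in> space M. X \<omega> \<le> x \<and> y < Y \<omega>} \<in> sets M"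
  by measurable

lemma m_le1: "m \<le> 1" unfolding marginal_df_def by (rule prob_le_1)

lemma one_minus_cond_df: "1 - cond_df M X Y x y = exceed y / m"
proof -
  have "m = joint_df M X Y x y + exceed y"
    unfolding marginal_df_def joint_df_def exceed_def
    by (subst finite_measure_Union[symmetric]) (auto intro!: arg_cong[where f = prob] measurable)
  then show ?thesis unfolding cond_df_def using marg_pos by (simp add: field_simps)
qed

lemma exceed_antimono: "y \<le> z \<Longrightarrow> exceed z \<le> exceed y"
  unfolding exceed_def by (intro finite_measure_mono) auto

lemma exceed_bounds: "0 \<le> exceed y" "exceed y \<le> m"
  unfolding exceed_def marginal_df_def by (auto intro!: finite_measure_mono)

lemma exceed_neg: "y < 0 \<Longrightarrow> exceed y = m"
  unfolding exceed_def marginal_df_def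
  by (intro arg_cong[where f = prob]) (use Y_nonneg in force)

lemma frontier_set_alt: "frontier_set M X Y x = {y. 0 \<le> y \<and> 0 < exceed y}"
proof -
  have "cond_df M X Y x y < 1 \<longleftrightarrow> 0 < exceed y" for y
  proof -
    have "cond_df M X Y x y < 1 \<longleftrightarrow> 0 < 1 - cond_df M X Y x y" by simp
    also have "\<dots> \<longleftrightarrow> 0 < exceed y" unfolding one_minus_cond_df using marg_pos by (simp add: zero_less_divide_iff)
    finally show ?thesis .
  qed
  then show ?thesis unfolding frontier_set_def by simp
qed

lemma bdd': "bdd_above (insert 0 (frontier_set M X Y x))" using bdd by simp

lemma frontier_nonneg: "0 \<le> \<phi>"
  unfolding frontier_fun_def by (rule cSup_upper[OF _ bdd']) simp

lemma exceed_above: "\<phi> < y \<Longrightarrow> exceed y = 0"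
proof (rule ccontr)
  assume y: "\<phi> < y" "exceed y \<noteq> 0"
  then have "y \<in> frontier_set M X Y x"
    using frontier_nonneg exceed_bounds(1)[of y] by (simp add: frontier_set_alt)
  then have "y \<le> \<phi>" unfolding frontier_fun_def by (intro cSup_upper bdd') simp
  then show False using y by simp
qed

text \<open>The event \<open>Y > \<phi>\<close> is the countable union of the null events \<open>Y > \<phi> + 1 / (n + 1)\<close>.\<close>

lemma exceed_frontier: "exceed \<phi> = 0"
proof -
  have "{\<omega> \<in> space M. X \<omega> \<le> x \<and> \<phi> + 1 / real (Suc n) < Y \<omega>} \<in> null_sets M" for n
  proof (rule null_setsI)
    have "exceed (\<phi> + 1 / real (Suc n)) = 0" by (rule exceed_above) simp
    then show "emeasure M {\<omega> \<in> space M. X \<omega> \<le> x \<and> \<phi> + 1 / real (Suc n) < Y \<omega>} = 0"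
      by (simp add: exceed_def emeasure_eq_measure)
  qed measurable
  then have "(\<Union>n. {\<omega> \<in> space M. X \<omega> \<le> x \<and> \<phi> + 1 / real (Suc n) < Y \<omega>}) \<in> null_sets M"
    by (rule null_sets_UN)
  moreover have "{\<omega> \<in> space M. X \<omega> \<le> x \<and> \<phi> < Y \<omega>} =
      (\<Union>n. {\<omega> \<in> space M. X \<omega> \<le> x \<and> \<phi> + 1 / real (Suc n) < Y \<omega>})" (is "?A = ?B")
  proof
    show "?A \<subseteq> ?B"
    proof
      fix \<omega> assume w: "\<omega> \<in> ?A"
      then have "0 < Y \<omega> - \<phi>" by simp
      then obtain n where "1 / real (Suc n) < Y \<omega> - \<phi>" using nat_approx_posE by blast
      then show "\<omega> \<in> ?B" using w by (intro UN_I[of n]) auto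
    qed
    show "?B \<subseteq> ?A"
    proof
      fix \<omega> assume "\<omega> \<in> ?B"
      then obtain n where "\<omega> \<in> space M" "X \<omega> \<le> x" "\<phi> + 1 / real (Suc n) < Y \<omega>" by blast
      moreover have "0 < 1 / real (Suc n)" by simp
      ultimately have "\<phi> < Y \<omega>" by linarith
      with \<open>\<omega> \<in> space M\<close> \<open>X \<omega> \<le> x\<close> show "\<omega> \<in> ?A" by simp
    qed
  qed
  ultimately show ?thesis by (simp add: exceed_def measure_def null_setsD1)
qed

lemma exceed_below: "y < \<phi> \<Longrightarrow> 0 < exceed y"
proof -
  assume y: "y < \<phi>"
  show ?thesis
  proof (cases "y < 0")
    case True
    then show ?thesis using exceed_neg marg_pos by simp
  next
    case False
    obtain z where z: "z \<in> insert 0 (frontier_set M X Y x)" "y < z"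
      using less_cSupD[of "insert 0 (frontier_set M X Y x)" y] y unfolding frontier_fun_def by blast
    then have "0 < exceed z" using False by (auto simp: frontier_set_alt)
    then show ?thesis using exceed_antimono[of y z] z by simp
  qed
qed

lemma V_mono: "mono V" unfolding V_def by (intro monoI exceed_antimono) simp
lemma V_pos: "0 < s \<Longrightarrow> 0 < V s" unfolding V_def by (rule exceed_below) simp
lemma V_bounds: "0 \<le> V s" "V s \<le> m" "V s \<le> 1"
  unfolding V_def using exceed_bounds[of "\<phi> - s"] m_le1 by simp_all
lemma V_beyond: "\<phi> < s \<Longrightarrow> V s = m" unfolding V_def by (rule exceed_neg) simp

text \<open>Substitute \<open>u = 1 / t\<close> and \<open>1 / z\<close> for \<open>z\<close>; the factor \<open>F\<^sub>X x\<close> cancels in the ratio.\<close>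

lemma frontier_RV_iff: "frontier_RV M X Y x \<rho> \<longleftrightarrow> regvar_zero V \<rho>"
proof -
  have eq: "(1 - cond_df M X Y x (\<phi> - 1 / (t * z))) / (1 - cond_df M X Y x (\<phi> - 1 / t)) =
      V (inverse t * inverse z) / V (inverse t)" for t z :: real
    unfolding one_minus_cond_df V_def using marg_pos by (simp add: inverse_eq_divide)
  have "frontier_RV M X Y x \<rho> \<longleftrightarrow>
      (\<forall>z>0. ((\<lambda>t. V (inverse t * inverse z) / V (inverse t)) \<longlongrightarrow> inverse z powr \<rho>) at_top)"
    unfolding frontier_RV_def eq by (simp add: powr_minus inverse_powr)
  also have "\<dots> \<longleftrightarrow> (\<forall>z>0. ((\<lambda>t. V (inverse t * z) / V (inverse t)) \<longlongrightarrow> z powr \<rho>) at_top)"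
    (is "(\<forall>z>0. ?P (inverse z)) \<longleftrightarrow> (\<forall>z>0. ?P z)")
  proof (intro iffI allI impI)
    fix z :: real assume *: "\<forall>z>0. ?P (inverse z)" and z: "0 < z"
    from z have "0 < inverse z" by simp
    with * have "?P (inverse (inverse z))" by blast
    then show "?P z" by (simp only: inverse_inverse_eq)
  next
    fix z :: real assume *: "\<forall>z>0. ?P z" and z: "0 < z"
    from z have "0 < inverse z" by simp
    with * show "?P (inverse z)" by blast
  qed
  also have "\<dots> \<longleftrightarrow> regvar_zero V \<rho>"
    unfolding regvar_zero_def by (simp add: filterlim_at_right_to_top)
  finally show ?thesis .
qed

lemma pair_meas: "(\<lambda>\<omega>. (Xs i \<omega>, Ys i \<omega>)) \<in> borel_measurable M"
  using indep unfolding indep_vars_def by simp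

lemma exceed_borel: "{p :: (real ^ 'p) \<times> real. fst p \<le> x \<and> y < snd p} \<in> sets borel"
proof -
  have "{..x} \<times> {y<..} \<in> sets (borel \<Otimes>\<^sub>M borel)"
    by (intro pair_measureI borel_closed[OF closed_eucl_atMost]) auto
  moreover have "{..x} \<times> {y<..} = {p :: (real ^ 'p) \<times> real. fst p \<le> x \<and> y < snd p}" by auto
  ultimately show ?thesis by (simp only: borel_prod)
qed

lemma sample_exceed:
  "{\<omega> \<in> space M. Xs i \<omega> \<le> x \<and> y < Ys i \<omega>} \<in> sets M"
  "prob {\<omega> \<in> space M. Xs i \<omega> \<le> x \<and> y < Ys i \<omega>} = exceed y"
proof -
  let ?B = "{p :: (real ^ 'p) \<times> real. fst p \<le> x \<and> y < snd p}"
  have pre: "(\<lambda>\<omega>. (Xs i \<omega>, Ys i \<omega>)) -` ?B \<inter> space M = {\<omega> \<in> space M. Xs i \<omega> \<le> x \<and> y < Ys i \<omega>}" by auto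
  have pre': "(\<lambda>\<omega>. (X \<omega>, Y \<omega>)) -` ?B \<inter> space M = {\<omega> \<in> space M. X \<omega> \<le> x \<and> y < Y \<omega>}" by auto
  have XY: "(\<lambda>\<omega>. (X \<omega>, Y \<omega>)) \<in> borel_measurable M" by (intro borel_measurable_Pair) measurable
  show "{\<omega> \<in> space M. Xs i \<omega> \<le> x \<and> y < Ys i \<omega>} \<in> sets M"
    using measurable_sets[OF pair_meas exceed_borel, of i y] unfolding pre .
  have "prob {\<omega> \<in> space M. Xs i \<omega> \<le> x \<and> y < Ys i \<omega>} = measure (distr M borel (\<lambda>\<omega>. (Xs i \<omega>, Ys i \<omega>))) ?B"
    by (simp only: measure_distr[OF pair_meas exceed_borel] pre)
  also have "\<dots> = exceed y"
    unfolding same by (simp only: measure_distr[OF XY exceed_borel] pre' exceed_def)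
  finally show "prob {\<omega> \<in> space M. Xs i \<omega> \<le> x \<and> y < Ys i \<omega>} = exceed y" .
qed

lemma est_le_iff: "est n \<omega> \<le> y \<longleftrightarrow> 0 \<le> y \<and> (\<forall>i<n. Xs i \<omega> \<le> x \<longrightarrow> Ys i \<omega> \<le> y)"
proof -
  have "finite {Ys i \<omega> | i. i < n \<and> Xs i \<omega> \<le> x}" by simp
  then show ?thesis unfolding fdh_eq_Max by (subst Max_le_iff) auto
qed

lemma est_nonneg: "0 \<le> est n \<omega>" using est_le_iff[of n \<omega> "est n \<omega>"] by simp

text \<open>For \<open>y < 0\<close> the equation can fail: the estimator is 0 when there is no observation with \<open>X \<le> x\<close>.\<close>

lemma est_event:
  assumes "0 \<le> y"
  shows "{\<omega> \<in> space M. est n \<omega> \<le> y} = space M - (\<Union>i<n. {\<omega> \<in> space M. Xs i \<omega> \<le> x \<and> y < Ys i \<omega>})"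
  using assms by (auto simp: est_le_iff not_less)

lemma est_meas [measurable]: "est n \<in> borel_measurable M"
proof (rule borel_measurableI_le)
  fix y show "{\<omega> \<in> space M. est n \<omega> \<le> y} \<in> sets M"
  proof (cases "0 \<le> y")
    case True
    show ?thesis unfolding est_event[OF True]
      by (intro sets.Diff sets.top sets.finite_UN sample_exceed(1)) auto
  next
    case False
    then have "{\<omega> \<in> space M. est n \<omega> \<le> y} = {}" by (auto simp: est_le_iff)
    then show ?thesis by (simp only: sets.empty_sets)
  qed
qed

lemma prob_est_le:
  assumes y: "0 \<le> y"
  shows "prob {\<omega> \<in> space M. est n \<omega> \<le> y} = (1 - exceed y) ^ n"
proof (cases "n = 0")
  case True
  then show ?thesis using y by (simp add: est_le_iff prob_space)
next
  case False
  define A where "A i = {\<omega> \<in> space M. \<not> (Xs i \<omega> \<le> x \<and> y < Ys i \<omega>)}" for i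
  have "space borel - {p :: (real ^ 'p) \<times> real. fst p \<le> x \<and> y < snd p} \<in> sets borel"
    by (intro sets.compl_sets exceed_borel)
  moreover have "space borel - {p :: (real ^ 'p) \<times> real. fst p \<le> x \<and> y < snd p} =
      {p \<in> space borel. \<not> (fst p \<le> x \<and> y < snd p)}" by auto
  ultimately have "{p \<in> space borel. \<not> (fst p \<le> x \<and> y < snd p)} \<in> sets (borel :: ((real ^ 'p) \<times> real) measure)"
    by simp
  then have "indep_events (\<lambda>i. {\<omega> \<in> space M. \<not> (fst (Xs i \<omega>, Ys i \<omega>) \<le> x \<and> y < snd (Xs i \<omega>, Ys i \<omega>))}) UNIV"
    by (intro indep_eventsI_indep_vars[OF indep])
  then have ind: "indep_events A UNIV" by (simp add: A_def[abs_def])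
  have "prob (A i) = 1 - exceed y" for i
  proof -
    have "A i = space M - {\<omega> \<in> space M. Xs i \<omega> \<le> x \<and> y < Ys i \<omega>}" by (auto simp: A_def)
    then show ?thesis using prob_compl[OF sample_exceed(1)] by (simp add: sample_exceed(2))
  qed
  moreover have "prob (\<Inter>i\<in>{..<n}. A i) = (\<Prod>i<n. prob (A i))"
    using ind False unfolding indep_events_def by blast
  moreover have "(\<Inter>i\<in>{..<n}. A i) = {\<omega> \<in> space M. est n \<omega> \<le> y}"
    using False y by (auto simp: A_def est_le_iff not_less)
  ultimately show ?thesis by simp
qed

lemma est_le_frontier: "AE \<omega> in M. est n \<omega> \<le> \<phi>"
  using prob_est_le[OF frontier_nonneg, of n] exceed_frontier
  by (intro AE_I_eq_1) (auto simp: emeasure_eq_measure)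

lemma prob_deviation:
  assumes b: "0 < b" and s: "0 < s"
  shows "prob {\<omega> \<in> space M. s \<le> inverse b * (\<phi> - est n \<omega>)} = (if b * s \<le> \<phi> then (1 - V (b * s)) ^ n else 0)"
proof -
  have eq: "s \<le> inverse b * (\<phi> - est n \<omega>) \<longleftrightarrow> est n \<omega> \<le> \<phi> - b * s" for \<omega>
    using b by (simp add: field_simps le_diff_eq)
  show ?thesis
  proof (cases "b * s \<le> \<phi>")
    case True
    then show ?thesis unfolding eq by (simp add: prob_est_le V_def)
  next
    case False
    then have "{\<omega> \<in> space M. est n \<omega> \<le> \<phi> - b * s} = {}" by (auto simp: est_le_iff)
    then show ?thesis unfolding eq using False by (simp only: measure_empty if_False)
  qed
qed

definition dev_df :: "(nat \<Rightarrow> real) \<Rightarrow> nat \<Rightarrow> real \<Rightarrow> real" where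
  "dev_df b n = cdf (distr M borel (\<lambda>\<omega>. inverse (b n) * (est n \<omega> - \<phi>)))"

lemma dev_df_eq: "dev_df b n y = prob {\<omega> \<in> space M. inverse (b n) * (est n \<omega> - \<phi>) \<le> y}"
  unfolding dev_df_def cdf_def
  by (subst measure_distr) (auto intro!: arg_cong[where f = prob])

lemma dev_df_mono: "mono (dev_df b n)"
  unfolding dev_df_eq by (intro monoI finite_measure_mono) auto

lemma dev_df_nonneg_arg:
  assumes "0 < b n" "0 \<le> y"
  shows "dev_df b n y = 1"
proof -
  have "AE \<omega> in M. inverse (b n) * (est n \<omega> - \<phi>) \<le> y"
    using est_le_frontier[of n]
  proof eventually_elim
    case (elim \<omega>)
    then have "inverse (b n) * (est n \<omega> - \<phi>) \<le> 0" using assms(1) by (simp add: mult_le_0_iff)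
    then show ?case using assms(2) by linarith
  qed
  then show ?thesis unfolding dev_df_eq by (subst prob_Collect_eq_1) auto
qed

lemma dev_df_neg_arg:
  assumes "0 < b n" "0 < s"
  shows "dev_df b n (- s) = (if b n * s \<le> \<phi> then (1 - V (b n * s)) ^ n else 0)"
proof -
  have "inverse (b n) * (est n \<omega> - \<phi>) \<le> - s \<longleftrightarrow> s \<le> inverse (b n) * (\<phi> - est n \<omega>)" for \<omega>
    by (simp add: algebra_simps)
  then show ?thesis unfolding dev_df_eq using prob_deviation[OF assms, of n] by simp
qed

text \<open>The two sides differ only if \<open>b n * s > \<phi>\<close>, and then \<open>V (b n * s)\<close> is the whole marginal mass.\<close>

lemma dev_df_neg_arg_diff:
  assumes b: "\<forall>n\<ge>1. 0 < b n" and s: "0 < s"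
  shows "(\<lambda>n. dev_df b n (- s) - (1 - V (b n * s)) ^ n) \<longlonglongrightarrow> 0"
proof -
  have "(\<lambda>n. (1 - m) ^ n) \<longlonglongrightarrow> 0" using m_le1 marg_pos by (intro LIMSEQ_realpow_zero) auto
  then show ?thesis
  proof (rule Lim_null_comparison[rotated])
    show "eventually (\<lambda>n. norm (dev_df b n (- s) - (1 - V (b n * s)) ^ n) \<le> (1 - m) ^ n) sequentially"
      using eventually_ge_at_top[of 1]
    proof eventually_elim
      case (elim n)
      show ?case using dev_df_neg_arg[of b n s] b elim s V_beyond[of "b n * s"] m_le1 by auto
    qed
  qed
qed

lemma dev_df_tendsto_iff:
  assumes b: "\<forall>n\<ge>1. 0 < b n" and s: "0 < s"
  shows "(\<lambda>n. dev_df b n (- s)) \<longlonglongrightarrow> l \<longleftrightarrow> (\<lambda>n. (1 - V (b n * s)) ^ n) \<longlonglongrightarrow> l"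
proof -
  note diff = dev_df_neg_arg_diff[OF b s]
  show ?thesis
  proof
    assume "(\<lambda>n. dev_df b n (- s)) \<longlonglongrightarrow> l"
    from tendsto_diff[OF this diff] show "(\<lambda>n. (1 - V (b n * s)) ^ n) \<longlonglongrightarrow> l" by simp
  next
    assume "(\<lambda>n. (1 - V (b n * s)) ^ n) \<longlonglongrightarrow> l"
    from tendsto_add[OF this diff] show "(\<lambda>n. dev_df b n (- s)) \<longlonglongrightarrow> l" by simp
  qed
qed

lemma dev_df_nonneg_tendsto:
  assumes b: "\<forall>n\<ge>1. 0 < b n" and y: "0 \<le> y"
  shows "(\<lambda>n. dev_df b n y) \<longlonglongrightarrow> 1"
  by (rule Lim_transform_eventually[OF tendsto_const])
     (rule eventually_mono[OF eventually_ge_at_top[of 1]], use b y in \<open>simp add: dev_df_nonneg_arg\<close>)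

lemma fdh_converges_iff: "fdh_converges M X Y Xs Ys x b G \<longleftrightarrow> (\<forall>y. isCont G y \<longrightarrow> (\<lambda>n. dev_df b n y) \<longlonglongrightarrow> G y)"
  unfolding fdh_converges_def weak_conv_def dev_df_def ..

text \<open>Every point is a continuity point of \<open>Psi \<rho>\<close>, and nonnegative arguments impose no condition because the
estimator never exceeds the frontier.\<close>

lemma converges_Psi_iff:
  assumes b: "\<forall>n\<ge>1. 0 < b n" and rho: "0 < \<rho>"
  shows "fdh_converges M X Y Xs Ys x b (Psi \<rho>) \<longleftrightarrow> (\<forall>s>0. (\<lambda>n. real n * V (b n * s)) \<longlonglongrightarrow> s powr \<rho>)"
proof -
  have "(\<forall>y. (\<lambda>n. dev_df b n y) \<longlonglongrightarrow> Psi \<rho> y) \<longleftrightarrow> (\<forall>s>0. (\<lambda>n. dev_df b n (- s)) \<longlonglongrightarrow> Psi \<rho> (- s))"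
  proof (intro iffI allI impI)
    fix y assume *: "\<forall>s>0. (\<lambda>n. dev_df b n (- s)) \<longlonglongrightarrow> Psi \<rho> (- s)"
    show "(\<lambda>n. dev_df b n y) \<longlonglongrightarrow> Psi \<rho> y"
    proof (cases "y < 0")
      case True
      then show ?thesis using *[rule_format, of "- y"] by simp
    next
      case False
      then show ?thesis using dev_df_nonneg_tendsto[OF b, of y] by (simp add: Psi_def)
    qed
  qed blast
  also have "\<dots> \<longleftrightarrow> (\<forall>s>0. (\<lambda>n. real n * V (b n * s)) \<longlonglongrightarrow> s powr \<rho>)"
  proof (intro all_cong1 imp_cong refl)
    fix s :: real assume s: "0 < s"
    have "(\<lambda>n. dev_df b n (- s)) \<longlonglongrightarrow> Psi \<rho> (- s) \<longleftrightarrow> (\<lambda>n. (1 - V (b n * s)) ^ n) \<longlonglongrightarrow> exp (- (s powr \<rho>))"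
      using dev_df_tendsto_iff[OF b s] s by (simp add: Psi_def)
    also have "\<dots> \<longleftrightarrow> (\<lambda>n. real n * V (b n * s)) \<longlonglongrightarrow> s powr \<rho>"
      using power_one_minus_tendsto_exp[of "\<lambda>n. V (b n * s)"]
        power_one_minus_tendsto_exp_converse[of "\<lambda>n. V (b n * s)"] V_bounds by blast
    finally show "(\<lambda>n. dev_df b n (- s)) \<longlonglongrightarrow> Psi \<rho> (- s) \<longleftrightarrow> (\<lambda>n. real n * V (b n * s)) \<longlonglongrightarrow> s powr \<rho>" .
  qed
  finally show ?thesis unfolding fdh_converges_iff using isCont_Psi[OF rho] by simp
qed

section \<open>Limit laws, norming constants and moments\<close>

lemma limit_law_powerlaw:
  assumes b: "\<forall>n\<ge>1. 0 < b n" and G: "distribution_function G" "\<not> degenerate_df G"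
    and conv: "fdh_converges M X Y Xs Ys x b G"
  obtains \<rho> \<kappa> where "0 < \<rho>" "0 < \<kappa>" "\<forall>s>0. G (- s) = exp (- (\<kappa> * s powr \<rho>))"
    "\<forall>y\<ge>0. G y = 1" "regvar_zero V \<rho>"
proof -
  obtain \<mu> where mu: "real_distribution \<mu>" "G = cdf \<mu>" using G(1) unfolding distribution_function_def by blast
  interpret mu: real_distribution \<mu> by (rule mu(1))
  have lim: "(\<lambda>n. dev_df b n y) \<longlonglongrightarrow> G y" if "isCont G y" for y
    using conv that unfolding fdh_converges_iff by blast
  have Gmono: "mono G" unfolding mu(2) by (intro monoI mu.cdf_nondecreasing)
  have one: "G y = 1" if y: "0 \<le> y" for y
  proof (rule ccontr)
    assume "G y \<noteq> 1"
    then have lt: "G y < 1" using mu.cdf_bounded_prob[of y] unfolding mu(2) by linarith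
    have "(G \<longlongrightarrow> G y) (at_right y)"
      using mu.cdf_is_right_cont[of y] unfolding mu(2) by (simp add: continuous_within)
    from order_tendstoD(2)[OF this lt] obtain c where c: "y < c" "\<And>z. y < z \<Longrightarrow> z < c \<Longrightarrow> G z < 1"
      unfolding eventually_at_right_field by blast
    obtain z where z: "z \<in> {y<..<c}" "z \<notin> {y. \<not> isCont G y}"
      using real_interval_avoid_countable_set[OF c(1) mono_ctble_discont[OF Gmono]] by blast
    have "(\<lambda>n. dev_df b n z) \<longlonglongrightarrow> G z" using lim z by blast
    moreover have "(\<lambda>n. dev_df b n z) \<longlonglongrightarrow> 1" using z y by (intro dev_df_nonneg_tendsto[OF b]) simp
    ultimately have "G z = 1" by (rule LIMSEQ_unique)
    then show False using c(2)[of z] z by simp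
  qed
  obtain y where y: "0 < G y" "G y < 1" using nondegenerate_df_intermediate[OF G] by blast
  then have y0: "y < 0" using one[of y] by linarith
  define h where "h s = cdf \<mu> (- s)" for s
  have h: "left_cont_tail h" unfolding h_def
    using reflected_df_left_cont_tail[OF mu(1) y0] y unfolding mu(2) by simp
  obtain \<rho> \<kappa> where rk: "0 < \<rho>" "0 < \<kappa>" "\<And>s. 0 < s \<Longrightarrow> h s = exp (- (\<kappa> * s powr \<rho>))"
  proof (rule limit_of_maxima_powerlaw[of V b "{s. isCont (cdf \<mu>) (- s)}" h "- y"])
    show "(\<lambda>n. (1 - V (b n * s)) ^ n) \<longlonglongrightarrow> h s" if "s \<in> {s. isCont (cdf \<mu>) (- s)}" "0 < s" for s
      using lim[of "- s"] that unfolding h_def mu(2) by (simp add: dev_df_tendsto_iff[OF b])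
    show "dense_in_pos {s. isCont (cdf \<mu>) (- s)}" by (rule reflected_df_continuity_dense[OF mu(1)])
    show "h s \<le> 1" for s unfolding h_def by (rule mu.cdf_bounded_prob)
    show "0 < b n" if "1 \<le> n" for n using b that by blast
    show "0 < h (- y)" "h (- y) < 1" using y by (simp_all add: h_def mu(2))
    show "0 < - y" using y0 by simp
  qed (use V_mono V_bounds h in auto)
  have Gh: "G (- s) = exp (- (\<kappa> * s powr \<rho>))" if "0 < s" for s
    using rk(3)[OF that] by (simp add: h_def mu(2))
  have "(\<lambda>n. real n * V (b n * s)) \<longlonglongrightarrow> \<kappa> * s powr \<rho>" if s: "0 < s" for s
  proof (rule power_one_minus_tendsto_exp_converse)
    have "isCont (\<lambda>y. exp (- (\<kappa> * (- y) powr \<rho>))) (- s)"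
      unfolding isCont_def using s by (intro tendsto_intros) auto
    moreover have "eventually (\<lambda>y. exp (- (\<kappa> * (- y) powr \<rho>)) = G y) (nhds (- s))"
    proof -
      have "eventually (\<lambda>y. y \<in> {..<0}) (nhds (- s))" using s by (intro eventually_nhds_in_open) auto
      then show ?thesis
      proof eventually_elim
        case (elim y)
        then show ?case using Gh[of "- y"] by simp
      qed
    qed
    ultimately have "isCont G (- s)" by (simp add: isCont_cong)
    from lim[OF this] show "(\<lambda>n. (1 - V (b n * s)) ^ n) \<longlonglongrightarrow> exp (- (\<kappa> * s powr \<rho>))"
      using s by (simp add: dev_df_tendsto_iff[OF b] Gh)
  qed (use V_bounds in auto)
  then have "regvar_zero V \<rho>"
    using b by (intro regvar_zero_of_sequence[OF V_mono V_pos, of b \<rho> \<kappa>] rk) auto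
  then show ?thesis using that rk(1,2) Gh one by blast
qed

lemma powerlaw_is_Psi:
  assumes "0 < \<rho>" "0 < \<kappa>" "\<forall>s>0. G (- s) = exp (- (\<kappa> * s powr \<rho>))" "\<forall>y\<ge>0. G y = 1"
  shows "\<exists>c>0. \<forall>y. G y = Psi \<rho> (y / c)"
proof (intro exI conjI allI)
  define c where "c = (1 / \<kappa>) powr (1 / \<rho>)"
  show c: "0 < c" using assms by (simp add: c_def)
  have cr: "c powr \<rho> = 1 / \<kappa>" using assms by (simp add: c_def powr_powr)
  fix y :: real
  show "G y = Psi \<rho> (y / c)"
  proof (cases "y < 0")
    case True
    have "(- (y / c)) powr \<rho> = (- y) powr \<rho> / c powr \<rho>"
      using True c by (simp add: powr_divide[symmetric])
    then have "(- (y / c)) powr \<rho> = \<kappa> * (- y) powr \<rho>" by (simp add: cr)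
    moreover have "y / c < 0" using True c by (simp add: divide_neg_pos)
    ultimately show ?thesis using assms(3)[rule_format, of "- y"] True by (simp add: Psi_def)
  next
    case False
    moreover have "\<not> y / c < 0" using False c by (simp add: divide_less_0_iff)
    ultimately show ?thesis using assms(4) by (simp add: Psi_def)
  qed
qed

text \<open>If the frontier is 0, then \<open>V\<close> is constant on the positive half-line, whereas regular variation with
positive index makes it vanish at 0.\<close>

lemma regvar_frontier_pos:
  assumes "0 < \<rho>" "regvar_zero V \<rho>"
  shows "0 < \<phi>"
proof (rule ccontr)
  assume "\<not> 0 < \<phi>"
  then have "\<phi> = 0" using frontier_nonneg by simp
  have "eventually (\<lambda>u. V u < m \<and> 0 < u) (at_right 0)"
    using order_tendstoD(2)[OF regvar_zero_tendsto_zero[OF V_mono V_pos assms] marg_pos]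
      eventually_at_right_less[of 0] by (auto intro: eventually_conj)
  then obtain u where "V u < m" "0 < u" by (auto dest!: eventually_happens)
  then show False using V_beyond[of u] \<open>\<phi> = 0\<close> by simp
qed

lemma quantile_norming_alt:
  assumes n: "1 \<le> n"
  shows "quantile_norming M X Y x n = \<phi> - Inf {y. 0 \<le> y \<and> exceed y \<le> 1 / real n}"
proof -
  have "1 - 1 / (real n * m) \<le> cond_df M X Y x y \<longleftrightarrow> exceed y \<le> 1 / real n" for y
  proof -
    have "1 - 1 / (real n * m) \<le> cond_df M X Y x y \<longleftrightarrow> 1 - cond_df M X Y x y \<le> (1 / real n) / m" by auto
    also have "\<dots> \<longleftrightarrow> exceed y \<le> 1 / real n"
      unfolding one_minus_cond_df using marg_pos by (simp only: divide_le_cancel) simp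
    finally show ?thesis .
  qed
  then show ?thesis unfolding quantile_norming_def cond_quantile_def by simp
qed

text \<open>The conditional quantile is the infimum of the \<open>y \<ge> 0\<close> with \<open>exceed y \<le> 1 / n\<close>, so \<open>V\<close> crosses the level
\<open>1 / n\<close> at the norming constant. The last claim asks for a large \<open>n\<close> since \<open>V\<close> never exceeds the marginal mass.\<close>

lemma quantile_norming_props:
  assumes rho: "0 < \<rho>" and rv: "regvar_zero V \<rho>" and n: "1 \<le> n"
  shows "0 < quantile_norming M X Y x n"
    and "0 < s \<Longrightarrow> s < quantile_norming M X Y x n \<Longrightarrow> V s \<le> 1 / real n"
    and "quantile_norming M X Y x n < s \<Longrightarrow> 1 / m \<le> real n \<Longrightarrow> 1 / real n \<le> V s"
proof -
  define S where "S = {y. 0 \<le> y \<and> exceed y \<le> 1 / real n}"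
  define q where "q = Inf S"
  have a: "quantile_norming M X Y x n = \<phi> - q" unfolding quantile_norming_alt[OF n] q_def S_def ..
  have phi: "\<phi> \<in> S" using exceed_frontier frontier_nonneg by (simp add: S_def)
  have bddS: "bdd_below S" unfolding bdd_below_def S_def by blast
  have pos: "0 < \<phi>" by (rule regvar_frontier_pos[OF rho rv])
  have inv: "0 < 1 / real n" using n by simp
  have "eventually (\<lambda>u. V u < 1 / real n \<and> u \<in> {0<..<\<phi>}) (at_right 0)"
    using order_tendstoD(2)[OF regvar_zero_tendsto_zero[OF V_mono V_pos rho rv] inv]
      eventually_at_right_real[OF pos] by (auto intro: eventually_conj)
  then obtain u where u: "V u < 1 / real n" "0 < u" "u < \<phi>" by (auto dest!: eventually_happens)
  then have "\<phi> - u \<in> S" by (simp add: S_def V_def)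
  then have "q \<le> \<phi> - u" unfolding q_def by (rule cInf_lower[OF _ bddS])
  then show "0 < quantile_norming M X Y x n" using u by (simp add: a)
  show "V s \<le> 1 / real n" if s: "0 < s" "s < quantile_norming M X Y x n"
  proof -
    have "q < \<phi> - s" using s by (simp add: a)
    then obtain y where y: "y \<in> S" "y < \<phi> - s"
      unfolding q_def using cInf_lessD[of S "\<phi> - s"] phi by blast
    have "V s \<le> exceed y" unfolding V_def using y by (intro exceed_antimono) simp
    then show ?thesis using y by (simp add: S_def)
  qed
  show "1 / real n \<le> V s" if s: "quantile_norming M X Y x n < s" and large: "1 / m \<le> real n"
  proof (cases "\<phi> < s")
    case True
    have "1 / real n \<le> m" using large marg_pos n by (simp add: field_simps)
    then show ?thesis using V_beyond[OF True] by simp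
  next
    case False
    have "\<phi> - s \<notin> S"
    proof
      assume "\<phi> - s \<in> S"
      then have "q \<le> \<phi> - s" unfolding q_def by (rule cInf_lower[OF _ bddS])
      then show False using s by (simp add: a)
    qed
    then show ?thesis using False by (simp add: S_def V_def)
  qed
qed

lemma quantile_norming_converges:
  assumes rho: "0 < \<rho>" and rv: "regvar_zero V \<rho>"
  shows "fdh_converges M X Y Xs Ys x (quantile_norming M X Y x) (Psi \<rho>)"
proof -
  define a where "a = quantile_norming M X Y x"
  note props = quantile_norming_props[OF rho rv, folded a_def]
  have ev: "eventually (\<lambda>n. 0 < a n \<and> (\<forall>s. 0 < s \<and> s < a n \<longrightarrow> V s \<le> 1 / real n) \<and>
      (\<forall>s>a n. 1 / real n \<le> V s)) sequentially"
  proof -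
    have "eventually (\<lambda>n::nat. 1 / m \<le> real n) sequentially"
      using filterlim_real_sequentially by (auto simp: filterlim_at_top)
    then show ?thesis
      using eventually_ge_at_top[of 1]
    proof eventually_elim
      case (elim n)
      then show ?case using props[OF elim(2)] by blast
    qed
  qed
  have pos: "\<forall>n\<ge>1. 0 < a n" using props(1) by blast
  show ?thesis
    unfolding a_def[symmetric] converges_Psi_iff[OF pos rho]
    using regvar_zero_quantile_scale[OF V_mono V_pos rho rv ev] by blast
qed

text \<open>For large \<open>n\<close> and \<open>1 \<le> s \<le> \<phi> / b n\<close> the Potter bound gives \<open>n * V (b n * s) \<ge> (c / 2) * s powr (\<rho> / 2)\<close>, because
\<open>n * V (b n)\<close> tends to 1; beyond \<open>\<phi> / b n\<close> the tail is 0.\<close>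

lemma moments_converge:
  assumes rho: "0 < \<rho>" and rv: "regvar_zero V \<rho>" and b: "\<forall>n\<ge>1. 0 < b n"
    and conv: "fdh_converges M X Y Xs Ys x b (Psi \<rho>)" and k: "1 \<le> k"
  shows "(\<lambda>n. expectation (\<lambda>\<omega>. (inverse (b n) * (\<phi> - est n \<omega>)) ^ k)) \<longlonglongrightarrow> Gamma (1 + real k / \<rho>)"
proof -
  have lim: "(\<lambda>n. real n * V (b n * s)) \<longlonglongrightarrow> s powr \<rho>" if "0 < s" for s
    using conv that unfolding converges_Psi_iff[OF b rho] by blast
  have lim1: "(\<lambda>n. real n * V (b n)) \<longlonglongrightarrow> 1" using lim[of 1] by simp
  have evb: "eventually (\<lambda>n. 0 < b n) sequentially"
    by (rule eventually_mono[OF eventually_ge_at_top[of 1]]) (use b in blast)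
  have b0: "filterlim b (at_right 0) sequentially"
    by (rule scale_tendsto_zero[OF V_mono V_pos evb tendsto_zero_of_mult_nat[OF lim1]])
  have phi: "0 < \<phi>" by (rule regvar_frontier_pos[OF rho rv])
  obtain c u0 where cu: "0 < c" "0 < u0"
    "\<forall>u s. 0 < u \<and> u \<le> u0 \<and> 1 \<le> s \<and> u * s \<le> \<phi> \<longrightarrow> c * s powr (\<rho>/2) * V u \<le> V (u * s)"
    using regvar_zero_lower_bound[OF V_mono V_pos rho rv phi] by auto
  \<comment> \<open>shifted by one, since \<open>b 0\<close> may have any sign\<close>
  define W where "W n \<omega> = inverse (b (Suc n)) * (\<phi> - est (Suc n) \<omega>)" for n \<omega>
  have bs: "0 < b (Suc n)" for n using b by simp
  have "(\<lambda>n. expectation (\<lambda>\<omega>. W n \<omega> ^ k)) \<longlonglongrightarrow> Gamma (1 + real k / \<rho>)"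
  proof (rule moments_converge_to_weibull[OF _ _ rho _ _ k, of W "c/2" "\<rho>/2"])
    show "W n \<in> borel_measurable M" for n unfolding W_def by measurable
    show "AE \<omega> in M. 0 \<le> W n \<omega>" for n
      using est_le_frontier[of "Suc n"]
      by eventually_elim (use bs[of n] in \<open>simp add: W_def\<close>)
    show "(\<lambda>n. prob {\<omega> \<in> space M. s \<le> W n \<omega>}) \<longlonglongrightarrow> exp (- (s powr \<rho>))" if s: "0 < s" for s
    proof -
      have "(\<lambda>n. dev_df b n (- s)) \<longlonglongrightarrow> exp (- (s powr \<rho>))"
        unfolding dev_df_tendsto_iff[OF b s]
        by (rule power_one_minus_tendsto_exp) (use V_bounds lim[OF s] in auto)
      from LIMSEQ_Suc[OF this] show ?thesis
        unfolding W_def using dev_df_neg_arg[of b, OF bs s] by (simp add: prob_deviation[OF bs s])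
    qed
    have "eventually (\<lambda>n. 0 < b n \<and> b n \<le> u0 \<and> 1/2 < real n * V (b n)) sequentially"
    proof -
      have "eventually (\<lambda>n. b n < u0) sequentially"
        using b0 cu(2) by (intro order_tendstoD(2)[of b 0]) (auto simp: filterlim_at)
      moreover have "eventually (\<lambda>n. 1/2 < real n * V (b n)) sequentially"
        by (rule order_tendstoD(1)[OF lim1]) simp
      ultimately show ?thesis using evb by eventually_elim simp
    qed
    then have "eventually (\<lambda>n. 0 < b (Suc n) \<and> b (Suc n) \<le> u0 \<and> 1/2 < real (Suc n) * V (b (Suc n))) sequentially"
      by (subst eventually_sequentially_Suc)
    then show "eventually (\<lambda>n. \<forall>s\<ge>1. prob {\<omega> \<in> space M. s \<le> W n \<omega>} \<le> exp (- (c / 2 * s powr (\<rho>/2)))) sequentially"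
    proof (eventually_elim, intro allI impI)
      fix n and s :: real
      assume e: "0 < b (Suc n) \<and> b (Suc n) \<le> u0 \<and> 1/2 < real (Suc n) * V (b (Suc n))" and s: "1 \<le> s"
      have s0: "0 < s" using s by simp
      show "prob {\<omega> \<in> space M. s \<le> W n \<omega>} \<le> exp (- (c / 2 * s powr (\<rho>/2)))"
      proof (cases "b (Suc n) * s \<le> \<phi>")
        case True
        define v where "v = V (b (Suc n) * s)"
        have "c * s powr (\<rho>/2) * V (b (Suc n)) \<le> v" unfolding v_def using cu(3) e s True by blast
        then have *: "real (Suc n) * (c * s powr (\<rho>/2) * V (b (Suc n))) \<le> real (Suc n) * v"
          by (intro mult_left_mono) auto
        have "c / 2 * s powr (\<rho>/2) = (c * s powr (\<rho>/2)) * (1/2)" by simp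
        also have "\<dots> \<le> (c * s powr (\<rho>/2)) * (real (Suc n) * V (b (Suc n)))"
          using e cu(1) by (intro mult_left_mono) auto
        also have "\<dots> = real (Suc n) * (c * s powr (\<rho>/2) * V (b (Suc n)))" by (simp only: mult_ac)
        also note *
        finally have big: "c / 2 * s powr (\<rho>/2) \<le> real (Suc n) * v" .
        have "prob {\<omega> \<in> space M. s \<le> W n \<omega>} = (1 - v) ^ Suc n"
          unfolding W_def v_def using True by (subst prob_deviation[OF bs s0]) simp
        also have "\<dots> \<le> exp (- v) ^ Suc n"
          using exp_ge_add_one_self[of "- v"] V_bounds(3) by (intro power_mono) (auto simp: v_def)
        also have "\<dots> = exp (- (real (Suc n) * v))" by (simp only: exp_of_nat_mult[symmetric] mult_minus_right)
        also have "\<dots> \<le> exp (- (c / 2 * s powr (\<rho>/2)))" using big by simp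
        finally show ?thesis .
      next
        case False
        then show ?thesis unfolding W_def by (subst prob_deviation[OF bs s0]) simp
      qed
    qed
  qed (use cu rho in auto)
  then show ?thesis unfolding W_def by (rule LIMSEQ_imp_Suc)
qed

text \<open>Centring and scaling commute with the affine change from the estimator to \<open>W n = (\<phi> - est n) / a n\<close>. Hence the
standardized estimator is at most \<open>y\<close> exactly if \<open>- W n\<close> is at most \<open>\<sigma> n * y - m1 n\<close>, where \<open>m1 n\<close> and \<open>\<sigma> n\<close> are the
mean and the standard deviation of \<open>W n\<close>.\<close>

lemma standardized_converges:
  assumes rho: "0 < \<rho>" and rv: "regvar_zero V \<rho>"
  shows "(\<lambda>n. prob {\<omega> \<in> space M. (est n \<omega> - expectation (est n)) / sqrt (variance (est n)) \<le> y})
    \<longlonglongrightarrow> Psi \<rho> (sqrt (Gamma (1 + 2 / \<rho>) - (Gamma (1 + 1 / \<rho>))\<^sup>2) * y - Gamma (1 + 1 / \<rho>))"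
proof -
  define a where "a = quantile_norming M X Y x"
  have a: "\<forall>n\<ge>1. 0 < a n" using quantile_norming_props(1)[OF rho rv] by (simp add: a_def)
  have conv: "fdh_converges M X Y Xs Ys x a (Psi \<rho>)"
    unfolding a_def by (rule quantile_norming_converges[OF rho rv])
  define W where "W n \<omega> = inverse (a n) * (\<phi> - est n \<omega>)" for n \<omega>
  define m1 m2 where "m1 n = expectation (W n)" and "m2 n = expectation (\<lambda>\<omega>. (W n \<omega>)\<^sup>2)" for n
  have m1: "m1 \<longlonglongrightarrow> Gamma (1 + 1 / \<rho>)" and m2: "m2 \<longlonglongrightarrow> Gamma (1 + 2 / \<rho>)"
    using moments_converge[OF rho rv a conv, of 1] moments_converge[OF rho rv a conv, of 2]
    unfolding m1_def[abs_def] m2_def[abs_def] W_def[abs_def] by simp_all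
  define \<sigma> where "\<sigma> n = sqrt (m2 n - (m1 n)\<^sup>2)" for n
  have lim_var: "(\<lambda>n. m2 n - (m1 n)\<^sup>2) \<longlonglongrightarrow> Gamma (1 + 2 / \<rho>) - (Gamma (1 + 1 / \<rho>))\<^sup>2"
    by (intro tendsto_intros m1 m2)
  have pos: "0 < Gamma (1 + 2 / \<rho>) - (Gamma (1 + 1 / \<rho>))\<^sup>2"
    using Gamma_square_less[of "1 / \<rho>"] rho by simp
  have int_est: "integrable M (est n)" and int_est2: "integrable M (\<lambda>\<omega>. (est n \<omega>)\<^sup>2)" for n
  proof -
    have bound: "AE \<omega> in M. norm (est n \<omega>) \<le> \<phi>"
      using est_le_frontier[of n] by eventually_elim (simp add: est_nonneg)
    then show "integrable M (est n)" by (intro integrable_const_bound) auto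
    have "AE \<omega> in M. norm ((est n \<omega>)\<^sup>2) \<le> \<phi>\<^sup>2"
      using bound by eventually_elim (simp add: est_nonneg power_mono)
    then show "integrable M (\<lambda>\<omega>. (est n \<omega>)\<^sup>2)" by (intro integrable_const_bound) auto
  qed
  have key: "prob {\<omega> \<in> space M. (est n \<omega> - expectation (est n)) / sqrt (variance (est n)) \<le> y}
      = dev_df a n (\<sigma> n * y - m1 n)" if n: "1 \<le> n" and v: "0 < m2 n - (m1 n)\<^sup>2" for n
  proof -
    have an: "0 < a n" using a n by blast
    have int1: "integrable M (W n)" unfolding W_def using int_est by simp
    have "(\<lambda>\<omega>. (W n \<omega>)\<^sup>2) = (\<lambda>\<omega>. (inverse (a n))\<^sup>2 * (\<phi>\<^sup>2 - 2 * \<phi> * est n \<omega> + (est n \<omega>)\<^sup>2))"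
      by (simp add: W_def power_mult_distrib power2_diff fun_eq_iff)
    then have int2: "integrable M (\<lambda>\<omega>. (W n \<omega>)\<^sup>2)" using int_est[of n] int_est2[of n] by simp
    have est_W: "est n \<omega> = \<phi> - a n * W n \<omega>" for \<omega>
      using an by (simp add: W_def mult.assoc[symmetric])
    have mean: "expectation (est n) = \<phi> - a n * m1 n"
      unfolding est_W using int1 by (simp add: m1_def prob_space)
    have "variance (est n) = expectation (\<lambda>\<omega>. (a n)\<^sup>2 * (W n \<omega> - m1 n)\<^sup>2)"
      unfolding mean by (intro Bochner_Integration.integral_cong refl)
        (simp add: est_W power_mult_distrib[symmetric] power2_commute algebra_simps)
    also have "\<dots> = (a n)\<^sup>2 * variance (W n)" by (simp add: m1_def)
    also have "variance (W n) = m2 n - (m1 n)\<^sup>2"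
      unfolding m1_def m2_def by (rule variance_eq[OF int1 int2])
    finally have sd: "sqrt (variance (est n)) = a n * \<sigma> n"
      using an by (simp add: real_sqrt_mult \<sigma>_def)
    have sig: "0 < \<sigma> n" using v by (simp add: \<sigma>_def)
    have "(est n \<omega> - expectation (est n)) / sqrt (variance (est n)) \<le> y \<longleftrightarrow>
        inverse (a n) * (est n \<omega> - \<phi>) \<le> \<sigma> n * y - m1 n" for \<omega>
    proof -
      have "est n \<omega> - expectation (est n) = a n * (m1 n - W n \<omega>)"
        unfolding mean by (subst est_W) (simp add: algebra_simps)
      then have "(est n \<omega> - expectation (est n)) / sqrt (variance (est n)) = (m1 n - W n \<omega>) / \<sigma> n"
        unfolding sd using an by simp
      moreover have "inverse (a n) * (est n \<omega> - \<phi>) = - W n \<omega>" by (simp add: W_def algebra_simps)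
      moreover have "(m1 n - W n \<omega>) / \<sigma> n \<le> y \<longleftrightarrow> - W n \<omega> \<le> \<sigma> n * y - m1 n"
        using sig by (simp add: pos_divide_le_eq) (simp add: mult.commute algebra_simps)
      ultimately show ?thesis by simp
    qed
    then show ?thesis unfolding dev_df_eq by simp
  qed
  have "(\<lambda>n. dev_df a n (\<sigma> n * y - m1 n)) \<longlonglongrightarrow>
      Psi \<rho> (sqrt (Gamma (1 + 2 / \<rho>) - (Gamma (1 + 1 / \<rho>))\<^sup>2) * y - Gamma (1 + 1 / \<rho>))"
  proof (rule monotone_limit_at_moving_point[where F = "dev_df a" and G = "Psi \<rho>" and ys = "\<lambda>n. \<sigma> n * y - m1 n"])
    show "mono (dev_df a n)" for n by (rule dev_df_mono)
    show "(\<lambda>n. dev_df a n z) \<longlonglongrightarrow> Psi \<rho> z" for z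
      using conv isCont_Psi[OF rho] unfolding fdh_converges_iff by blast
    show "(\<lambda>n. \<sigma> n * y - m1 n) \<longlonglongrightarrow>
        sqrt (Gamma (1 + 2 / \<rho>) - (Gamma (1 + 1 / \<rho>))\<^sup>2) * y - Gamma (1 + 1 / \<rho>)"
      unfolding \<sigma>_def by (intro tendsto_intros lim_var m1)
  qed (rule isCont_Psi[OF rho])
  then show ?thesis
  proof (rule Lim_transform_eventually)
    show "eventually (\<lambda>n. dev_df a n (\<sigma> n * y - m1 n) =
        prob {\<omega> \<in> space M. (est n \<omega> - expectation (est n)) / sqrt (variance (est n)) \<le> y}) sequentially"
      using order_tendstoD(1)[OF lim_var pos] eventually_ge_at_top[of 1]
      by eventually_elim (simp add: key)
  qed
qed

end

theorem theorem2p1: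
  fixes M :: "'a measure"
    and X :: "'a \<Rightarrow> real ^ 'p" and Y :: "'a \<Rightarrow> real"
    and Xs :: "nat \<Rightarrow> 'a \<Rightarrow> real ^ 'p" and Ys :: "nat \<Rightarrow> 'a \<Rightarrow> real"
    and x :: "real ^ 'p"
  assumes "prob_space M"
    and "X \<in> borel_measurable M" and "Y \<in> borel_measurable M"
    and "\<forall>\<omega>\<in>space M. 0 \<le> X \<omega> \<and> 0 \<le> Y \<omega>"
    and "prob_space.indep_vars M (\<lambda>_. borel) (\<lambda>i \<omega>. (Xs i \<omega>, Ys i \<omega>)) UNIV"
    and "\<forall>i. distr M borel (\<lambda>\<omega>. (Xs i \<omega>, Ys i \<omega>)) = distr M borel (\<lambda>\<omega>. (X \<omega>, Y \<omega>))"
    and "0 \<le> x" and "0 < marginal_df M X x"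
    and "bdd_above (frontier_set M X Y x)"
  shows
    "(\<forall>b G. (\<forall>n\<ge>1. 0 < b n) \<and> distribution_function G \<and> \<not> degenerate_df G \<and>
            fdh_converges M X Y Xs Ys x b G
        \<longrightarrow> (\<exists>\<rho>>0. \<exists>c>0. \<forall>y. G y = Psi \<rho> (y / c)))
     \<and>
     ((\<exists>b. (\<forall>n\<ge>1. 0 < b n) \<and>
           (\<exists>G. distribution_function G \<and> \<not> degenerate_df G \<and> fdh_converges M X Y Xs Ys x b G))
        \<longleftrightarrow> (\<exists>\<rho>>0. frontier_RV M X Y x \<rho>))
     \<and>
     (\<forall>\<rho>>0. (\<exists>b. (\<forall>n\<ge>1. 0 < b n) \<and> fdh_converges M X Y Xs Ys x b (Psi \<rho>))
        \<longleftrightarrow> frontier_RV M X Y x \<rho>)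
     \<and>
     (\<forall>\<rho>>0. frontier_RV M X Y x \<rho> \<longrightarrow>
        (\<forall>n\<ge>1. 0 < quantile_norming M X Y x n) \<and>
        fdh_converges M X Y Xs Ys x (quantile_norming M X Y x) (Psi \<rho>))
     \<and>
     (\<forall>\<rho>>0. frontier_RV M X Y x \<rho> \<longrightarrow>
        (\<forall>b. (\<forall>n\<ge>1. 0 < b n) \<and> fdh_converges M X Y Xs Ys x b (Psi \<rho>) \<longrightarrow>
           (\<forall>k::nat. k \<ge> 1 \<longrightarrow>
              (\<lambda>n. prob_space.expectation M
                     (\<lambda>\<omega>. (inverse (b n) * (frontier_fun M X Y x - fdh Xs Ys n x \<omega>)) ^ k))
              \<longlonglongrightarrow> Gamma (1 + real k / \<rho>))) \<and>
        (\<forall>y. (\<lambda>n. measure M {\<omega> \<in> space M.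
                  (fdh Xs Ys n x \<omega> - prob_space.expectation M (fdh Xs Ys n x))
                    / sqrt (prob_space.variance M (fdh Xs Ys n x)) \<le> y})
              \<longlonglongrightarrow> Psi \<rho> (sqrt (Gamma (1 + 2 / \<rho>) - (Gamma (1 + 1 / \<rho>))\<^sup>2) * y
                             - Gamma (1 + 1 / \<rho>))))"
  proof -
  interpret frontier_sample M X Y Xs Ys x
    using assms unfolding frontier_sample_def frontier_sample_axioms_def by auto
  have law: "\<exists>\<rho>>0. (\<exists>c>0. \<forall>y. G y = Psi \<rho> (y / c)) \<and> frontier_RV M X Y x \<rho>"
    if "\<forall>n\<ge>1. 0 < b n" "distribution_function G" "\<not> degenerate_df G" "fdh_converges M X Y Xs Ys x b G" for b G
  proof (rule limit_law_powerlaw[OF that])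
    fix \<rho> \<kappa> assume "0 < \<rho>" "0 < \<kappa>" "\<forall>s>0. G (- s) = exp (- (\<kappa> * s powr \<rho>))"
      "\<forall>y\<ge>0. G y = 1" "regvar_zero V \<rho>"
    then show ?thesis using powerlaw_is_Psi[of \<rho> \<kappa> G] frontier_RV_iff by blast
  qed
  have norming: "(\<forall>n\<ge>1. 0 < quantile_norming M X Y x n) \<and>
      fdh_converges M X Y Xs Ys x (quantile_norming M X Y x) (Psi \<rho>)" if "0 < \<rho>" "frontier_RV M X Y x \<rho>" for \<rho>
    using quantile_norming_props(1) quantile_norming_converges that unfolding frontier_RV_iff by blast
  have nondegenerate: "distribution_function (Psi \<rho>) \<and> \<not> degenerate_df (Psi \<rho>)" if "0 < \<rho>" for \<rho>
    using Psi_distribution_function[OF that] Psi_nondegenerate[OF that] by blast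
  have RV: "frontier_RV M X Y x \<rho>"
    if "\<forall>n\<ge>1. 0 < b n" "0 < \<rho>" "fdh_converges M X Y Xs Ys x b (Psi \<rho>)" for b \<rho>
    unfolding frontier_RV_iff
  proof (rule regvar_zero_of_sequence[OF V_mono V_pos, of b \<rho> 1])
    show "(\<lambda>n. real n * V (b n * s)) \<longlonglongrightarrow> 1 * s powr \<rho>" if "0 < s" for s
      using \<open>fdh_converges M X Y Xs Ys x b (Psi \<rho>)\<close> that
      unfolding converges_Psi_iff[OF \<open>\<forall>n\<ge>1. 0 < b n\<close> \<open>0 < \<rho>\<close>] by simp
  qed (use that in auto)
  show ?thesis
  proof (intro conjI allI impI)
    fix b G assume *: "(\<forall>n\<ge>1. 0 < b n) \<and> distribution_function G \<and> \<not> degenerate_df G \<and>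
      fdh_converges M X Y Xs Ys x b G"
    show "\<exists>\<rho>>0. \<exists>c>0. \<forall>y. G y = Psi \<rho> (y / c)" using law[of b G] * by blast
  next
    show "(\<exists>b. (\<forall>n\<ge>1. 0 < b n) \<and>
           (\<exists>G. distribution_function G \<and> \<not> degenerate_df G \<and> fdh_converges M X Y Xs Ys x b G))
        \<longleftrightarrow> (\<exists>\<rho>>0. frontier_RV M X Y x \<rho>)"
    proof
      assume "\<exists>b. (\<forall>n\<ge>1. 0 < b n) \<and>
           (\<exists>G. distribution_function G \<and> \<not> degenerate_df G \<and> fdh_converges M X Y Xs Ys x b G)"
      then obtain b G where "\<forall>n\<ge>1. 0 < b n" "distribution_function G" "\<not> degenerate_df G"
        "fdh_converges M X Y Xs Ys x b G" by blast
      from law[OF this] show "\<exists>\<rho>>0. frontier_RV M X Y x \<rho>" by blast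
    next
      assume "\<exists>\<rho>>0. frontier_RV M X Y x \<rho>"
      then obtain \<rho> where "0 < \<rho>" "frontier_RV M X Y x \<rho>" by blast
      from norming[OF this] nondegenerate[OF this(1)]
      show "\<exists>b. (\<forall>n\<ge>1. 0 < b n) \<and>
           (\<exists>G. distribution_function G \<and> \<not> degenerate_df G \<and> fdh_converges M X Y Xs Ys x b G)" by blast
    qed
  next
    fix \<rho> :: real assume "0 < \<rho>"
    then show "(\<exists>b. (\<forall>n\<ge>1. 0 < b n) \<and> fdh_converges M X Y Xs Ys x b (Psi \<rho>)) \<longleftrightarrow> frontier_RV M X Y x \<rho>"
      using RV norming by blast
  next
    fix \<rho> :: real and n :: nat assume "0 < \<rho>" "frontier_RV M X Y x \<rho>" "1 \<le> n"
    then show "0 < quantile_norming M X Y x n" using norming by blast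
  next
    fix \<rho> :: real assume "0 < \<rho>" "frontier_RV M X Y x \<rho>"
    then show "fdh_converges M X Y Xs Ys x (quantile_norming M X Y x) (Psi \<rho>)" using norming by blast
  next
    fix \<rho> :: real and b :: "nat \<Rightarrow> real" and k :: nat
    assume "0 < \<rho>" "frontier_RV M X Y x \<rho>"
      "(\<forall>n\<ge>1. 0 < b n) \<and> fdh_converges M X Y Xs Ys x b (Psi \<rho>)" "1 \<le> k"
    then show "(\<lambda>n. expectation (\<lambda>\<omega>. (inverse (b n) * (\<phi> - est n \<omega>)) ^ k)) \<longlonglongrightarrow> Gamma (1 + real k / \<rho>)"
      using moments_converge[of \<rho> b k] unfolding frontier_RV_iff by blast
  next
    fix \<rho> y :: real assume "0 < \<rho>" "frontier_RV M X Y x \<rho>"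
    then show "(\<lambda>n. prob {\<omega> \<in> space M. (est n \<omega> - expectation (est n)) / sqrt (variance (est n)) \<le> y})
        \<longlonglongrightarrow> Psi \<rho> (sqrt (Gamma (1 + 2 / \<rho>) - (Gamma (1 + 1 / \<rho>))\<^sup>2) * y - Gamma (1 + 1 / \<rho>))"
      using standardized_converges[of \<rho> y] unfolding frontier_RV_iff by blast
  qed
qed

end
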